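(* Define integers $u2(n)$, $n\in\mathbb{N}_0$, by \[ \sum_{n\ge0}u2(n)q^n:=\sum_{n\ge1}\frac{\left(-q^2;q^2\right)_{n-1}^2q^{2n}}{\left(q;q^2\right)_{n}}\qquad(|q|<1). \] Then $u2(n)$ is odd if and only if $8n-1=3^b\ell^2p^c$, where $p$ is a prime congruent to $5$ or $23$ modulo $24$, $p\nmid\ell$, $b\in\mathbb{N}_0$, $\ell\in\mathbb{N}$, and $c\equiv1\pmod 4$.
   Context: For $n\in\mathbb{N}_0\cup\{\infty\}$, $(a;q)_n:=\prod_{j=0}^{n-1}(1-aq^j)$. Combinatorially, $u2(n)$ counts unimodal sequences of size $n$ whose largest part is even, all of whose odd parts appear to the left of the peak, and whose subsequence of even parts is strongly unimodal. *)

theory Defs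
  imports "HOL-Analysis.Analysis"
begin

definition qpoch :: "complex \<Rightarrow> complex \<Rightarrow> nat \<Rightarrow> complex" where
  "qpoch a q n = (\<Prod>j<n. 1 - a * q ^ j)"

text \<open>The summation index is shifted: the summand with index \<open>n\<close> here is the one with
  index \<open>n + 1\<close> in the series \<open>\<Sum>n\<ge>1\<close>.\<close>
definition u2_series :: "complex \<Rightarrow> complex" where
  "u2_series q =
     (\<Sum>n. (qpoch (- (q ^ 2)) (q ^ 2) n) ^ 2 * q ^ (2 * (n + 1)) / qpoch q (q ^ 2) (n + 1))"

definition u2 :: "nat \<Rightarrow> int" where
  "u2 = (THE u. \<forall>q. norm q < 1 \<longrightarrow> (\<lambda>n. of_int (u n) * q ^ n) sums u2_series q)"

text \<open>The rest of this theory shows that the series converges absolutely in the unit disc and that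
  there is exactly one such integer sequence, so that the description of \<open>u2\<close> is proper.\<close>

definition nat_expansion :: "(complex \<Rightarrow> complex) \<Rightarrow> (nat \<Rightarrow> nat) \<Rightarrow> bool" where
  "nat_expansion f a \<longleftrightarrow> (\<forall>q. norm q < 1 \<longrightarrow> (\<lambda>k. of_nat (a k) * q ^ k) sums f q)"

lemma nat_expansion_norm:
  assumes "nat_expansion f a" "norm (q::complex) < 1"
  shows "summable (\<lambda>k. norm (of_nat (a k) * q ^ k))"
    and "complex_of_real (\<Sum>k. norm (of_nat (a k) * q ^ k)) = f (of_real (norm q))"
proof -
  have *: "(\<lambda>k. of_nat (a k) * complex_of_real (norm q) ^ k) sums f (of_real (norm q))"
    using assms unfolding nat_expansion_def by simp
  have eq: "of_nat (a k) * complex_of_real (norm q) ^ k = of_real (norm (of_nat (a k) * q ^ k))" for k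
    by (simp add: norm_mult norm_power)
  have **: "(\<lambda>k. complex_of_real (norm (of_nat (a k) * q ^ k))) sums f (of_real (norm q))"
    using * unfolding eq .
  show s: "summable (\<lambda>k. norm (of_nat (a k) * q ^ k))"
    using sums_summable[OF **] summable_complex_of_real by blast
  show "complex_of_real (\<Sum>k. norm (of_nat (a k) * q ^ k)) = f (of_real (norm q))"
    using sums_of_real[OF summable_sums[OF s], where 'a=complex] ** sums_unique2 by blast
qed

lemma nat_expansion_mult:
  assumes "nat_expansion f a" "nat_expansion g b"
  shows "nat_expansion (\<lambda>q. f q * g q) (\<lambda>n. \<Sum>i\<le>n. a i * b (n - i))"
  unfolding nat_expansion_def
proof (intro allI impI)
  fix q :: complex assume q: "norm q < 1"
  have "(\<lambda>n. \<Sum>i\<le>n. (of_nat (a i) * q ^ i) * (of_nat (b (n - i)) * q ^ (n - i))) sums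
     ((\<Sum>k. of_nat (a k) * q ^ k) * (\<Sum>k. of_nat (b k) * q ^ k))"
    using nat_expansion_norm(1)[OF assms(1) q] nat_expansion_norm(1)[OF assms(2) q]
    by (rule Cauchy_product_sums)
  also have "(\<lambda>n. \<Sum>i\<le>n. (of_nat (a i) * q ^ i) * (of_nat (b (n - i)) * q ^ (n - i))) =
     (\<lambda>n. of_nat (\<Sum>i\<le>n. a i * b (n - i)) * q ^ n)"
  proof
    fix n
    have "(of_nat (a i) * q ^ i) * (of_nat (b (n - i)) * q ^ (n - i)) =
       of_nat (a i * b (n - i)) * q ^ n" if "i \<le> n" for i
      using that by (simp add: power_add[symmetric] mult.assoc mult.left_commute)
    then have "(\<Sum>i\<le>n. (of_nat (a i) * q ^ i) * (of_nat (b (n - i)) * q ^ (n - i))) =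
       (\<Sum>i\<le>n. of_nat (a i * b (n - i)) * q ^ n)"
      by (intro sum.cong) auto
    then show "(\<Sum>i\<le>n. (of_nat (a i) * q ^ i) * (of_nat (b (n - i)) * q ^ (n - i))) =
       of_nat (\<Sum>i\<le>n. a i * b (n - i)) * q ^ n"
      by (simp only: of_nat_sum sum_distrib_right)
  qed
  also have "(\<Sum>k. of_nat (a k) * q ^ k) = f q"
    using assms(1) q unfolding nat_expansion_def by (metis sums_unique)
  also have "(\<Sum>k. of_nat (b k) * q ^ k) = g q"
    using assms(2) q unfolding nat_expansion_def by (metis sums_unique)
  finally show "(\<lambda>n. of_nat (\<Sum>i\<le>n. a i * b (n - i)) * q ^ n) sums (f q * g q)" .
qed

lemma nat_expansion_power: "nat_expansion (\<lambda>q. q ^ m) (\<lambda>k. if k = m then 1 else 0)"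
  unfolding nat_expansion_def
proof (intro allI impI)
  fix q :: complex
  have "(\<lambda>k. if k = m then q ^ k else 0) sums q ^ m"
    using sums_single[of m "\<lambda>k. q ^ k"] by simp
  then show "(\<lambda>k. of_nat (if k = m then 1 else 0) * q ^ k) sums q ^ m"
    by (rule back_subst[where P = "\<lambda>s. s sums q ^ m"]) auto
qed

lemma nat_expansion_add:
  assumes "nat_expansion f a" "nat_expansion g b"
  shows "nat_expansion (\<lambda>q. f q + g q) (\<lambda>k. a k + b k)"
  using assms unfolding nat_expansion_def by (auto simp: ring_distribs intro: sums_add)

lemma nat_expansion_geometric:
  assumes m: "m > 0"
  shows "nat_expansion (\<lambda>q. 1 / (1 - q ^ m)) (\<lambda>k. if m dvd k then 1 else 0)"
  unfolding nat_expansion_def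
proof (intro allI impI)
  fix q :: complex assume q: "norm q < 1"
  have "norm (q ^ m) < 1" using q m by (simp add: norm_power power_less_one_iff)
  then have "(\<lambda>k. (q ^ m) ^ k) sums (1 / (1 - q ^ m))" by (rule geometric_sums)
  then have "(\<lambda>k. of_nat (if m dvd (m * k) then 1 else 0) * q ^ (m * k)) sums (1 / (1 - q ^ m))"
    by (simp add: power_mult)
  moreover have "strict_mono (\<lambda>k. m * k)" using m by (simp add: strict_mono_def)
  ultimately show "(\<lambda>k. of_nat (if m dvd k then 1 else 0) * q ^ k) sums (1 / (1 - q ^ m))"
    by (subst (asm) sums_mono_reindex[where f = "\<lambda>k. of_nat (if m dvd k then 1 else 0) * q ^ k"])
       (auto simp: dvd_def)
qed

definition u2_term :: "nat \<Rightarrow> complex \<Rightarrow> complex" where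
  "u2_term n q = (qpoch (- (q ^ 2)) (q ^ 2) n) ^ 2 * q ^ (2 * (n + 1)) / qpoch q (q ^ 2) (n + 1)"

lemma u2_term_0: "u2_term 0 q = q ^ 2 * (1 / (1 - q ^ 1))"
  by (simp add: u2_term_def qpoch_def)

lemma u2_term_Suc:
  "u2_term (Suc n) q = u2_term n q * (q ^ 2 * ((q ^ 0 + q ^ (2 * n + 2)) * (q ^ 0 + q ^ (2 * n + 2)))
     * (1 / (1 - q ^ (2 * n + 3))))"
proof -
  have "qpoch (- (q ^ 2)) (q ^ 2) (Suc n) = qpoch (- (q ^ 2)) (q ^ 2) n * (1 + q ^ (2 * n + 2))"
    by (simp add: qpoch_def power_mult[symmetric] power_add[symmetric] add.commute)
  moreover have "qpoch q (q ^ 2) (Suc n + 1) = qpoch q (q ^ 2) (n + 1) * (1 - q ^ (2 * n + 3))"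
    by (simp add: qpoch_def power_mult[symmetric] numeral_3_eq_3)
  ultimately show ?thesis
    by (simp add: u2_term_def power2_eq_square mult_ac)
qed

lemma nat_expansion_u2_term: "\<exists>a. nat_expansion (u2_term n) a"
proof (induction n)
  case 0
  show ?case
    using nat_expansion_mult[OF nat_expansion_power[of 2] nat_expansion_geometric[of 1]]
    unfolding u2_term_0[abs_def] by auto
next
  case (Suc n)
  then obtain a where a: "nat_expansion (u2_term n) a" by blast
  note s = nat_expansion_add[OF nat_expansion_power[of 0] nat_expansion_power[of "2 * n + 2"]]
  have "2 * n + 3 > 0" by simp
  note g = nat_expansion_geometric[OF this]
  show ?case
    unfolding u2_term_Suc[abs_def]
    using nat_expansion_mult[OF a nat_expansion_mult[OF nat_expansion_mult[OF
      nat_expansion_power[of 2] nat_expansion_mult[OF s s]] g]] by blast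
qed

lemma summable_norm_u2_term:
  assumes q: "norm q < 1"
  shows "summable (\<lambda>n. norm (u2_term n q))"
proof -
  define r where "r n = q ^ 2 * ((q ^ 0 + q ^ (2 * n + 2)) * (q ^ 0 + q ^ (2 * n + 2)))
     * (1 / (1 - q ^ (2 * n + 3)))" for n
  have p: "(\<lambda>n. q ^ (2 * n + k)) \<longlonglongrightarrow> 0" for k
  proof -
    have "norm (q ^ 2) < 1" using q by (simp add: norm_power power_less_one_iff)
    then have "(\<lambda>n. (q ^ 2) ^ n * q ^ k) \<longlonglongrightarrow> 0 * q ^ k"
      by (intro tendsto_intros LIMSEQ_power_zero)
    then show ?thesis by (simp add: power_add power_mult)
  qed
  have "r \<longlonglongrightarrow> q ^ 2 * ((q ^ 0 + 0) * (q ^ 0 + 0)) * (1 / (1 - 0))"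
    unfolding r_def by (intro tendsto_intros p) auto
  then have "(\<lambda>n. norm (r n)) \<longlonglongrightarrow> norm (q ^ 2)" using tendsto_norm by force
  moreover have "norm (q ^ 2) < 1" using q by (simp add: norm_power power_less_one_iff)
  then obtain c where c: "norm (q ^ 2) < c" "c < 1" using dense by blast
  ultimately have "eventually (\<lambda>n. norm (r n) < c) sequentially" by (simp add: order_tendstoD)
  then obtain N where N: "\<And>n. n \<ge> N \<Longrightarrow> norm (r n) < c" by (auto simp: eventually_sequentially)
  show ?thesis
  proof (rule summable_ratio_test[of c N])
    show "norm (norm (u2_term (Suc n) q)) \<le> c * norm (norm (u2_term n q))" if "n \<ge> N" for n
    proof -
      have "norm (u2_term (Suc n) q) = norm (r n) * norm (u2_term n q)"
        by (simp only: u2_term_Suc r_def norm_mult mult.commute)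
      also have "\<dots> \<le> c * norm (u2_term n q)"
        using N[OF that] by (intro mult_right_mono) auto
      finally show ?thesis by simp
    qed
  qed (use c in auto)
qed

lemma u2_series_has_sum:
  assumes q: "norm q < 1"
  shows "((\<lambda>n. u2_term n q) has_sum u2_series q) UNIV"
proof -
  have "u2_series q = (\<Sum>n. u2_term n q)" by (simp add: u2_series_def u2_term_def)
  then show ?thesis
    using norm_summable_imp_has_sum[OF summable_norm_u2_term[OF q]]
      summable_sums[OF summable_norm_cancel[OF summable_norm_u2_term[OF q]]] by simp
qed

lemma u2_expansion_exists: "\<exists>b. nat_expansion u2_series b"
proof -
  obtain a where a: "\<And>n. nat_expansion (u2_term n) (a n)"
    using nat_expansion_u2_term by metis
  have summ: "(\<lambda>x. norm (case x of (n, k) \<Rightarrow> of_nat (a n k) * q ^ k)) summable_on UNIV \<times> UNIV"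
    if q: "norm (q::complex) < 1" for q
  proof (rule Infinite_Sum.abs_summable_on_Sigma_iff[THEN iffD2], intro conjI ballI)
    fix n :: nat
    have s: "summable (\<lambda>k. norm (of_nat (a n k) * q ^ k))"
      by (rule nat_expansion_norm(1)[OF a q])
    show "(\<lambda>k. norm (case (n, k) of (n, k) \<Rightarrow> of_nat (a n k) * q ^ k)) summable_on UNIV"
      using s by (simp add: summable_on_UNIV_nonneg_real_iff)
  next
    have "(\<Sum>\<^sub>\<infinity>k. norm (of_nat (a n k) * q ^ k)) = norm (u2_term n (of_real (norm q)))" for n
    proof -
      have s: "summable (\<lambda>k. norm (of_nat (a n k) * q ^ k))"
        by (rule nat_expansion_norm(1)[OF a q])
      have "(\<Sum>\<^sub>\<infinity>k. norm (of_nat (a n k) * q ^ k)) = (\<Sum>k. norm (of_nat (a n k) * q ^ k))"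
        using sums_nonneg_imp_has_sum[OF summable_sums[OF s]] infsumI by fastforce
      moreover have "(\<Sum>k. norm (of_nat (a n k) * q ^ k)) \<ge> 0" by (intro suminf_nonneg s) simp
      ultimately show ?thesis using nat_expansion_norm(2)[OF a q, of n] 
        by (metis norm_of_real abs_of_nonneg)
    qed
    moreover have "summable (\<lambda>n. norm (u2_term n (of_real (norm q))))"
      using q by (intro summable_norm_u2_term) simp
    ultimately show "(\<lambda>n. norm (\<Sum>\<^sub>\<infinity>k. norm (case (n, k) of (n, k) \<Rightarrow> of_nat (a n k) * q ^ k))) summable_on UNIV"
      by (simp add: summable_on_UNIV_nonneg_real_iff)
  qed
  have fin: "finite {n. a n k \<noteq> 0}" for k
  proof -
    have "(\<lambda>(k, n). of_nat (a n k) * (1/2::complex) ^ k) summable_on UNIV \<times> UNIV"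
      using abs_summable_summable[OF summ[of "1/2"]]
      by (subst summable_on_swap) (simp add: case_prod_unfold norm_divide)
    then have "(\<lambda>n. of_nat (a n k) * (1/2::complex) ^ k) summable_on UNIV"
      by (rule summable_on_SigmaD1) auto
    then have "(\<lambda>n. of_nat (a n k) * (1/2::complex) ^ k) \<longlonglongrightarrow> 0"
      by (intro summable_LIMSEQ_zero summable_on_imp_summable)
    then have "(\<lambda>n. of_nat (a n k) * (1/2::complex) ^ k * 2 ^ k) \<longlonglongrightarrow> 0 * 2 ^ k"
      by (intro tendsto_intros)
    then have "(\<lambda>n. of_nat (a n k) :: complex) \<longlonglongrightarrow> 0"
      by (simp add: power_divide)
    then have "\<forall>\<^sub>F n in sequentially. norm (of_nat (a n k) :: complex) < 1"
      by (intro order_tendstoD(2)[OF tendsto_norm_zero]) auto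
    then have "\<forall>\<^sub>F n in sequentially. a n k = 0"
      by (rule eventually_mono) simp
    then show ?thesis
      by (simp add: cofinite_eq_sequentially[symmetric] eventually_cofinite)
  qed
  define b where "b k = (\<Sum>n | a n k \<noteq> 0. a n k)" for k
  have "nat_expansion u2_series b"
    unfolding nat_expansion_def
  proof (intro allI impI)
    fix q :: complex assume q: "norm q < 1"
    define f where "f = (\<lambda>(n, k). of_nat (a n k) * q ^ k)"
    have s: "f summable_on UNIV \<times> UNIV"
      unfolding f_def by (rule abs_summable_summable[OF summ[OF q]])
    then obtain S where S: "(f has_sum S) (UNIV \<times> UNIV)" by (auto simp: summable_on_def)
    have "((\<lambda>n. u2_term n q) has_sum S) UNIV"
    proof (rule has_sum_SigmaD[OF S])
      fix n
      have "(\<lambda>k. of_nat (a n k) * q ^ k) sums u2_term n q"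
        using a q unfolding nat_expansion_def by blast
      then show "((\<lambda>k. f (n, k)) has_sum u2_term n q) UNIV"
        using norm_summable_imp_has_sum[OF nat_expansion_norm(1)[OF a q]] by (simp add: f_def)
    qed
    then have "S = u2_series q" using u2_series_has_sum[OF q] has_sum_unique by blast
    moreover have "((\<lambda>k. of_nat (b k) * q ^ k) has_sum S) UNIV"
    proof (rule has_sum_SigmaD[where f = "\<lambda>(k, n). f (n, k)" and B = "\<lambda>_. UNIV"])
      show "((\<lambda>(k, n). f (n, k)) has_sum S) (UNIV \<times> UNIV)"
        using S by (subst (asm) has_sum_swap)
      fix k
      have "((\<lambda>n. f (n, k)) has_sum (\<Sum>n | a n k \<noteq> 0. f (n, k))) {n. a n k \<noteq> 0}"
        by (rule has_sum_finite[OF fin])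
      then have "((\<lambda>n. f (n, k)) has_sum (\<Sum>n | a n k \<noteq> 0. f (n, k))) UNIV"
        by (rule has_sum_cong_neutral[THEN iffD1, rotated -1]) (auto simp: f_def)
      moreover have "(\<Sum>n | a n k \<noteq> 0. f (n, k)) = of_nat (b k) * q ^ k"
        by (simp add: f_def b_def sum_distrib_right)
      ultimately show "((\<lambda>n. case (k, n) of (k, n) \<Rightarrow> f (n, k)) has_sum (of_nat (b k) * q ^ k)) UNIV"
        by simp
    qed
    ultimately show "(\<lambda>k. of_nat (b k) * q ^ k) sums u2_series q"
      using has_sum_imp_sums by blast
  qed
  then show ?thesis by blast
qed

lemma u2_ex1:
  "\<exists>!u :: nat \<Rightarrow> int. \<forall>q. norm q < 1 \<longrightarrow> (\<lambda>n. of_int (u n) * q ^ n) sums u2_series q"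
proof (rule ex_ex1I)
  obtain b where "nat_expansion u2_series b" using u2_expansion_exists by blast
  then have "\<forall>q. norm q < 1 \<longrightarrow> (\<lambda>n. of_int (int (b n)) * q ^ n) sums u2_series q"
    by (simp add: nat_expansion_def)
  then show "\<exists>u :: nat \<Rightarrow> int. \<forall>q. norm q < 1 \<longrightarrow> (\<lambda>n. of_int (u n) * q ^ n) sums u2_series q"
    by (rule exI[of _ "\<lambda>n. int (b n)"])
next
  fix u v :: "nat \<Rightarrow> int"
  assume u: "\<forall>q. norm q < 1 \<longrightarrow> (\<lambda>n. of_int (u n) * q ^ n) sums u2_series q"
    and v: "\<forall>q. norm q < 1 \<longrightarrow> (\<lambda>n. of_int (v n) * q ^ n) sums u2_series q"
  have conv: "fps_conv_radius (Abs_fps (\<lambda>n. complex_of_int (w n))) > 0"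
    if w: "\<forall>q. norm q < 1 \<longrightarrow> (\<lambda>n. of_int (w n) * q ^ n) sums u2_series q" for w :: "nat \<Rightarrow> int"
  proof -
    have "summable (\<lambda>n. complex_of_int (w n) * (1/2) ^ n)"
      by (rule sums_summable[OF w[rule_format]]) (simp add: norm_divide)
    then have "conv_radius (\<lambda>n. complex_of_int (w n)) \<ge> norm (1/2 :: complex)"
      by (rule conv_radius_geI)
    then have "conv_radius (\<lambda>n. complex_of_int (w n)) \<ge> ereal (1/2)"
      by (simp add: norm_divide)
    moreover have "(0::ereal) < ereal (1/2)" by simp
    ultimately have "0 < conv_radius (\<lambda>n. complex_of_int (w n))"
      by (rule less_le_trans[rotated])
    then show ?thesis by (simp add: fps_conv_radius_def)
  qed
  have ev: "eval_fps (Abs_fps (\<lambda>n. complex_of_int (w n))) q = u2_series q"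
    if w: "\<forall>q. norm q < 1 \<longrightarrow> (\<lambda>n. of_int (w n) * q ^ n) sums u2_series q" and q: "norm q < 1"
    for w :: "nat \<Rightarrow> int" and q
    using sums_unique[OF w[rule_format, OF q]] by (simp add: eval_fps_def)
  have "\<forall>\<^sub>F q in nhds 0. q \<in> ball (0::complex) 1"
    by (rule eventually_nhds_in_open) auto
  then have "\<forall>\<^sub>F q in nhds 0. eval_fps (Abs_fps (\<lambda>n. complex_of_int (u n))) q
      = eval_fps (Abs_fps (\<lambda>n. complex_of_int (v n))) q"
    by (rule eventually_mono) (simp add: ev[OF u] ev[OF v])
  then have "Abs_fps (\<lambda>n. complex_of_int (u n)) = Abs_fps (\<lambda>n. complex_of_int (v n))"
    by (rule eval_fps_eqD[OF conv[OF u] conv[OF v]])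
  then show "u = v" by (simp add: fps_eq_iff fun_eq_iff)
qed

lemma u2_sums:
  assumes "norm q < 1"
  shows "(\<lambda>n. of_int (u2 n) * q ^ n) sums u2_series q"
  using theI'[OF u2_ex1] assms unfolding u2_def by blast

end

theory Submission
  imports Defs "HOL-Number_Theory.Number_Theory"
begin

text \<open>
  Modulo 2 the summands may be replaced by
  \<open>(-1)\<^sup>j q\<^bsup>2j+2\<^esup> (q\<^sup>4;q\<^sup>4)\<^sub>j / (q;q\<^sup>2)\<^bsub>j+1\<^esub>\<close>. Expanding \<open>(q\<^sup>4;q\<^sup>4)\<^sub>j\<close> by Lebesgue's identity and
  collecting terms gives finite sums \<open>D\<^sub>r\<close> which satisfy a first order recurrence in \<open>r\<close> (found by
  creative telescoping); solving it turns the series into the indefinite theta series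
  \<open>\<Sum>\<^bsub>z\<ge>1\<^esub> \<Sum>\<^bsub>0\<le>k<2z\<^esub> q\<^bsup>3z\<^sup>2 - k(k+1)/2\<^esup>\<close>. With \<open>x = 2k + 1\<close> and \<open>y = 2z\<close>, the parity of \<open>u2(n)\<close> is that
  of the number of solutions of \<open>6y\<^sup>2 - x\<^sup>2 = 8n - 1\<close>, \<open>0 < x < 2y\<close>, that is, of elements of norm
  \<open>-(8n - 1)\<close> in \<open>\<int>[\<surd>6]\<close> up to units and conjugation.

  The primitive solutions for \<open>M \<equiv> 7 (mod 8)\<close> are half as many as the square roots of 6 modulo \<open>M\<close>.
  By the Chinese remainder theorem the latter number is divisible by 4 unless \<open>M = 3\<^sup>a p\<^sup>e\<close>
  with \<open>a \<le> 1\<close> and \<open>p\<close> prime, and then quadratic reciprocity decides. Sorting all solutions by their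
  greatest common divisor finally leaves a count of the ways to write \<open>8n - 1 = 3\<^sup>a p\<^sup>e g\<^sup>2\<close>.
\<close>

section \<open>A truncated Hecke-type identity\<close>

definition qprod :: "'a::comm_ring_1 \<Rightarrow> nat \<Rightarrow> nat \<Rightarrow> 'a" where
  "qprod h a n = (\<Prod>i<n. 1 - h ^ (2 * (a + i)))"

lemma qprod_0 [simp]: "qprod h a 0 = 1"
  by (simp add: qprod_def)

lemma qprod_Suc_right: "qprod h a (Suc n) = qprod h a n * (1 - h ^ (2 * (a + n)))"
  by (simp add: qprod_def)

lemma qprod_Suc_left: "qprod h a (Suc n) = (1 - h ^ (2 * a)) * qprod h (Suc a) n"
  unfolding qprod_def by (subst prod.lessThan_Suc_shift) simp

text \<open>\<open>qprod h a n\<close> is the q-shifted factorial (h^(2a); h^2)_n. Lebesgue's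
  identity, specialised and cleared of denominators, says that these terms sum over all m to (h^4;
  h^4)_j.\<close>

definition lebesgue_term :: "'a::comm_ring_1 \<Rightarrow> nat \<Rightarrow> nat \<Rightarrow> 'a" where
  "lebesgue_term h j m = h ^ (m * (m + 1)) * qprod h (m + 1) (2 * j + 1)"

lemma lebesgue_term_0: "lebesgue_term h 0 m = h ^ (m * (m + 1)) - h ^ (Suc m * (Suc m + 1))"
proof -
  have "Suc m * (Suc m + 1) = m * (m + 1) + 2 * (m + 1)" by simp
  then have "h ^ (Suc m * (Suc m + 1)) = h ^ (m * (m + 1)) * h ^ (2 * (m + 1))"
    by (simp only: power_add)
  then show ?thesis by (simp add: lebesgue_term_def qprod_Suc_right algebra_simps)
qed

text \<open>The right-hand side is a difference in \<open>m\<close>, so summing over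
  \<open>m\<close> telescopes and multiplies the total by the next factor of (h^4; h^4)_j.\<close>

lemma lebesgue_term_Suc:
  "lebesgue_term h (Suc j) m - (1 - h ^ (4 * Suc j)) * lebesgue_term h j m =
     h ^ (4 * Suc j) * (h ^ (m * (m + 1)) * qprod h m (2 * Suc j)
       - h ^ (Suc m * (Suc m + 1)) * qprod h (Suc m) (2 * Suc j))"
proof -
  define w where "w = qprod h (Suc m) (2 * j + 1)"
  define x where "x = h ^ (2 * m)"
  define y where "y = h ^ (4 * j)"
  have "2 * (Suc m + (2 * j + 1)) = 4 * j + 4 + 2 * m" by simp
  then have p1: "h ^ (2 * (Suc m + (2 * j + 1))) = y * h ^ 4 * x"
    unfolding x_def y_def by (simp only: power_add)
  have "2 * (Suc m + (2 * j + 2)) = 4 * j + 4 + 2 * m + 2" by simp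
  then have p2: "h ^ (2 * (Suc m + (2 * j + 2))) = y * h ^ 4 * x * h ^ 2"
    unfolding x_def y_def by (simp only: power_add)
  have "2 * Suc j = Suc (2 * j + 1)" "2 * Suc j + 1 = Suc (Suc (2 * j + 1))"
    "Suc (2 * j + 1) = 2 * j + 2" by simp_all
  then have q1: "qprod h (Suc m) (2 * Suc j) = w * (1 - y * h ^ 4 * x)"
    and q2: "qprod h (Suc m) (2 * Suc j + 1) = w * (1 - y * h ^ 4 * x) * (1 - y * h ^ 4 * x * h ^ 2)"
    by (metis qprod_Suc_right w_def p1 p2)+
  have q3: "qprod h m (2 * Suc j) = (1 - x) * w"
    using qprod_Suc_left[of h m "2 * j + 1"] unfolding w_def x_def by simp
  have k1: "h ^ (4 * Suc j) = y * h ^ 4"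
    by (simp add: y_def power_add)
  have k2: "h ^ (Suc m * (Suc m + 1)) = h ^ (m * (m + 1)) * x * h ^ 2"
  proof -
    have "Suc m * (Suc m + 1) = m * (m + 1) + 2 * m + 2" by simp
    then show ?thesis unfolding x_def by (simp only: power_add)
  qed
  \<comment> \<open>Once all powers are written in \<open>x\<close> and \<open>y\<close>, a
    polynomial identity remains, with common factor h^(m(m+1)) \<open>w\<close>.\<close>
  have "h ^ (m * (m + 1)) * (w * (1 - y * h ^ 4 * x) * (1 - y * h ^ 4 * x * h ^ 2)) -
      (1 - y * h ^ 4) * (h ^ (m * (m + 1)) * w) =
      y * h ^ 4 * (h ^ (m * (m + 1)) * ((1 - x) * w) - h ^ (m * (m + 1)) * x * h ^ 2 * (w * (1 - y * h ^ 4 * x)))"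
    by (simp add: algebra_simps eval_nat_numeral)
  then show ?thesis
    by (simp only: lebesgue_term_def Suc_eq_plus1[symmetric, of m] w_def[symmetric] k1 k2 q1 q2 q3)
qed

text \<open>Divisibility replaces convergence, which a general ring lacks. In the induction on
  \<open>j\<close>, the boundary term left at \<open>m = M\<close> by telescoping carries the factor
  h^(M(M+1)).\<close>

lemma lebesgue_truncated:
  "h ^ (M * (M + 1)) dvd (\<Prod>i<j. 1 - h ^ (4 * Suc i)) - (\<Sum>m<M. lebesgue_term h j m)"
proof (induction j)
  case 0
  have "(\<Sum>m<M. lebesgue_term h 0 m) = 1 - h ^ (M * (M + 1))"
    unfolding lebesgue_term_0
    using sum_lessThan_telescope'[of "\<lambda>m. h ^ (m * (m + 1))" M] by simp
  then show ?case by simp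
next
  case (Suc j)
  let ?f = "\<lambda>m. h ^ (m * (m + 1)) * qprod h m (2 * Suc j)"
  have "(\<Sum>m<M. lebesgue_term h (Suc j) m) - (1 - h ^ (4 * Suc j)) * (\<Sum>m<M. lebesgue_term h j m)
     = h ^ (4 * Suc j) * (\<Sum>m<M. ?f m - ?f (Suc m))"
    unfolding sum_distrib_left sum_subtractf[symmetric] lebesgue_term_Suc by simp
  also have "(\<Sum>m<M. ?f m - ?f (Suc m)) = ?f 0 - ?f M"
    by (rule sum_lessThan_telescope')
  \<comment> \<open>\<open>qprod h 0\<close> starts with the factor 1 - h^0.\<close>
  also have "?f 0 = 0"
    by (simp add: qprod_Suc_left)
  finally have eq: "(\<Sum>m<M. lebesgue_term h (Suc j) m) =
      (1 - h ^ (4 * Suc j)) * (\<Sum>m<M. lebesgue_term h j m) - h ^ (4 * Suc j) * ?f M"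
    by (simp add: algebra_simps)
  have "(\<Prod>i<Suc j. 1 - h ^ (4 * Suc i)) - (\<Sum>m<M. lebesgue_term h (Suc j) m) =
     (1 - h ^ (4 * Suc j)) * ((\<Prod>i<j. 1 - h ^ (4 * Suc i)) - (\<Sum>m<M. lebesgue_term h j m))
     + h ^ (M * (M + 1)) * (h ^ (4 * Suc j) * qprod h M (2 * Suc j))"
    unfolding eq prod.lessThan_Suc by (simp only: algebra_simps)
  then show ?case
    using Suc.IH by (metis dvd_add dvd_mult dvd_triv_left)
qed

section \<open>Creative telescoping along the diagonals\<close>

locale inverse_odd_products =
  fixes h :: "'a::comm_ring_1" and e :: "nat \<Rightarrow> 'a"
  assumes e_0: "e 0 = 1"
    and e_Suc: "e (Suc j) * (1 - h ^ (2 * j + 1)) = e j"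
begin

text \<open>\<open>e j\<close> stands for 1/(h; h^2)_j, avoiding division. The index
  \<open>r\<close> equals j + m for the Lebesgue index m, so fixing \<open>r\<close> gathers the
  double series along a diagonal.\<close>

definition summand :: "nat \<Rightarrow> nat \<Rightarrow> 'a" where
  "summand r j = (- 1) ^ j * h ^ (2 * j) * lebesgue_term h j (r - j) * e (Suc j)"

text \<open>The telescoping companion of \<open>summand\<close>: up to the factor 1 + h^(2r+1), its
  differences in \<open>j\<close> give the recurrence operator in \<open>r\<close> applied to
  \<open>summand\<close>.\<close>

definition certificate :: "nat \<Rightarrow> nat \<Rightarrow> 'a" where
  "certificate r j = (if j > r then 0 else
     (- 1) ^ j * h ^ (2 * r + (r - j) * (r - j + 1)) * qprod h (r - j + 1) (2 * j) * e j)"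

lemma summand_recurrence:
  assumes "j < r"
  shows "summand r j - h ^ (6 * r + 3) * summand (r - 1) j = (1 + h ^ (2 * r + 1)) * (certificate r j - certificate r (Suc j))"
proof -
  \<comment> \<open>This removes the truncated subtractions. Every power of \<open>h\<close> then
    becomes a product of \<open>x\<close>, \<open>y\<close>, \<open>c\<close> and a fixed power of
    \<open>h\<close>, and a polynomial identity remains.\<close>
  obtain m where r: "r = j + Suc m" using assms less_imp_Suc_add by auto
  define w where "w = qprod h (Suc (Suc m)) (2 * j)"
  define x where "x = h ^ (2 * j)"
  define y where "y = h ^ (2 * m)"
  define E where "E = e (Suc j)"
  define c where "c = h ^ (m * (m + 1))"
  define s where "s = ((- 1) ^ j :: 'a)"
  have "2 * (Suc (Suc m) + 2 * j) = 2 * m + 4 + 2 * j + 2 * j" by simp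
  then have "h ^ (2 * (Suc (Suc m) + 2 * j)) = y * h ^ 4 * x ^ 2"
    unfolding x_def y_def power2_eq_square by (simp only: power_add mult.assoc)
  then have q1: "qprod h (Suc (Suc m)) (2 * j + 1) = w * (1 - y * h ^ 4 * x ^ 2)"
    by (simp add: qprod_Suc_right w_def)
  have q2: "qprod h (Suc m) (2 * j + 1) = (1 - y * h ^ 2) * w"
    unfolding w_def y_def by (simp add: qprod_Suc_left power_add[symmetric])
  have q3: "qprod h (Suc m) (2 * Suc j) = (1 - y * h ^ 2) * w * (1 - y * h ^ 4 * x ^ 2)"
    using q1 qprod_Suc_left[of h "Suc m" "2 * j + 1"] unfolding y_def
    by (simp add: power_add[symmetric] mult.assoc)
  have "Suc m * (Suc m + 1) = m * (m + 1) + 2 * m + 2" by simp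
  then have "h ^ (Suc m * (Suc m + 1)) = c * y * h ^ 2"
    unfolding c_def y_def by (simp only: power_add)
  then have d1: "summand r j = s * x * (c * y * h ^ 2 * (w * (1 - y * h ^ 4 * x ^ 2))) * E"
    unfolding summand_def lebesgue_term_def r E_def s_def x_def[symmetric] using q1 by simp
  have d2: "summand (r - 1) j = s * x * (c * ((1 - y * h ^ 2) * w)) * E"
    unfolding summand_def lebesgue_term_def r E_def s_def x_def[symmetric] c_def using q2 by simp
  have p1: "2 * (j + Suc m) + Suc m * (Suc m + 1) = 2 * j + 2 * m + 2 * m + 4 + m * (m + 1)"
    by (simp add: algebra_simps)
  have p2: "2 * (j + Suc m) + m * (m + 1) = 2 * j + 2 * m + 2 + m * (m + 1)"
    by (simp add: algebra_simps)
  have ej: "e j = E * (1 - x * h)"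
    using e_Suc[of j] unfolding E_def x_def by (simp add: mult.commute)
  have g1: "certificate r j = s * (x * y * y * h ^ 4 * c) * w * (E * (1 - x * h))"
  proof -
    have "certificate r j = s * h ^ (2 * (j + Suc m) + Suc m * (Suc m + 1)) * w * e j"
      unfolding certificate_def r s_def w_def by simp
    also have "\<dots> = s * (x * y * y * h ^ 4 * c) * w * e j"
      unfolding p1 x_def y_def c_def by (simp only: power_add)
    finally show ?thesis unfolding ej .
  qed
  have g2: "certificate r (Suc j) = - s * (x * y * h ^ 2 * c) * ((1 - y * h ^ 2) * w * (1 - y * h ^ 4 * x ^ 2)) * E"
  proof -
    have "certificate r (Suc j) = - s * h ^ (2 * (j + Suc m) + m * (m + 1)) * qprod h (Suc m) (2 * Suc j) * E"
      unfolding certificate_def r s_def E_def by simp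
    also have "\<dots> = - s * (x * y * h ^ 2 * c) * qprod h (Suc m) (2 * Suc j) * E"
      unfolding p2 x_def y_def c_def by (simp only: power_add)
    finally show ?thesis unfolding q3 .
  qed
  have k: "h ^ (6 * r + 3) = x ^ 3 * y ^ 3 * h ^ 9"
  proof -
    have "6 * r + 3 = 2 * j * 3 + 2 * m * 3 + 9" unfolding r by simp
    then show ?thesis unfolding x_def y_def by (simp only: power_add power_mult)
  qed
  have k2: "h ^ (2 * r + 1) = x * y * h ^ 3"
  proof -
    have "2 * r + 1 = 2 * j + 2 * m + 3" unfolding r by simp
    then show ?thesis unfolding x_def y_def by (simp only: power_add)
  qed
  show ?thesis unfolding d1 d2 g1 g2 k k2 by (simp add: algebra_simps eval_nat_numeral)
qed

text \<open>The term j = r has no partner in the sum for r - 1; it cancels the boundary value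
  \<open>certificate r r\<close> left by telescoping over j < r.\<close>

lemma summand_diagonal: "summand r r = (1 + h ^ (2 * r + 1)) * certificate r r"
proof -
  define w where "w = qprod h 1 (2 * r)"
  define x where "x = h ^ (2 * r)"
  have ej: "e r = e (Suc r) * (1 - x * h)"
    using e_Suc[of r] unfolding x_def by (simp add: mult.commute)
  have "2 * (1 + 2 * r) = 2 * r + 2 * r + 2" by simp
  then have "h ^ (2 * (1 + 2 * r)) = x * x * h ^ 2"
    unfolding x_def by (simp only: power_add)
  then have q: "qprod h 1 (2 * r + 1) = w * (1 - x * x * h ^ 2)"
    by (simp add: w_def qprod_Suc_right)
  have d: "summand r r = (-1) ^ r * x * (w * (1 - x * x * h ^ 2)) * e (Suc r)"
    using q unfolding summand_def lebesgue_term_def x_def by simp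
  have g: "certificate r r = (-1) ^ r * x * w * (e (Suc r) * (1 - x * h))"
    unfolding ej[symmetric] unfolding certificate_def w_def x_def by simp
  have k: "h ^ (2 * r + 1) = x * h" by (simp add: x_def)
  show ?thesis unfolding d g k by (simp add: algebra_simps eval_nat_numeral)
qed

text \<open>For r = 0 the sum on the right is empty, so the truncated r - 1 is harmless and the
  recurrence also supplies its own initial value.\<close>

lemma sum_summand_recurrence:
  "(\<Sum>j\<le>r. summand r j) = h ^ (6 * r + 3) * (\<Sum>j<r. summand (r - 1) j) + (1 + h ^ (2 * r + 1)) * h ^ (r * r + 3 * r)"
proof -
  have "(\<Sum>j<r. summand r j) - h ^ (6 * r + 3) * (\<Sum>j<r. summand (r - 1) j)
     = (\<Sum>j<r. (1 + h ^ (2 * r + 1)) * (certificate r j - certificate r (Suc j)))"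
    unfolding sum_distrib_left sum_subtractf[symmetric] by (intro sum.cong) (simp_all only: summand_recurrence lessThan_iff)
  also have "\<dots> = (1 + h ^ (2 * r + 1)) * (certificate r 0 - certificate r r)"
    unfolding sum_distrib_left[symmetric] using sum_lessThan_telescope'[of "certificate r" r] by simp
  also have "certificate r 0 = h ^ (r * r + 3 * r)"
    unfolding certificate_def by (simp add: e_0 algebra_simps)
  finally show ?thesis
    unfolding lessThan_Suc_atMost[symmetric] sum.lessThan_Suc summand_diagonal by (simp add: algebra_simps)
qed

text \<open>With z = r + 1, the factor h^(6z+3) of the recurrence is exactly the change from 3z^2 to
  3(z+1)^2; the inhomogeneous part supplies the two new indices k = 2z and k = 2z + 1.\<close>

lemma hecke_term:
  "h ^ 2 * (\<Sum>j\<le>r. summand r j) = (\<Sum>k<2 * Suc r. h ^ (3 * (Suc r) ^ 2 - k * (k + 1) div 2))"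
proof (induction r)
  case 0
  show ?case
    unfolding sum_summand_recurrence
    by (simp add: numeral_2_eq_2 numeral_3_eq_3 algebra_simps)
next
  case (Suc r)
  define z where "z = Suc r"
  have IH: "h ^ 2 * (\<Sum>j<z. summand (z - 1) j) = (\<Sum>k<2 * z. h ^ (3 * z ^ 2 - k * (k + 1) div 2))"
    using Suc unfolding z_def by (simp add: lessThan_Suc_atMost)
  have sh: "h ^ (6 * z + 3) * h ^ (3 * z ^ 2 - k * (k + 1) div 2) = h ^ (3 * (Suc z) ^ 2 - k * (k + 1) div 2)"
    if "k < 2 * z" for k
  proof -
    \<comment> \<open>This bound makes the natural subtraction in the exponent exact.\<close>
    have "k * (k + 1) \<le> 2 * z * (2 * z)" using that by (intro mult_mono) auto
    then have "k * (k + 1) div 2 \<le> 3 * z ^ 2" by (simp add: power2_eq_square)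
    then have "6 * z + 3 + (3 * z ^ 2 - k * (k + 1) div 2) = 3 * (Suc z) ^ 2 - k * (k + 1) div 2"
      by (simp add: power2_eq_square algebra_simps)
    then show ?thesis by (simp only: power_add[symmetric])
  qed
  have "h ^ 2 * (\<Sum>j\<le>z. summand z j) = h ^ (6 * z + 3) * (h ^ 2 * (\<Sum>j<z. summand (z - 1) j)) +
      h ^ 2 * ((1 + h ^ (2 * z + 1)) * h ^ (z * z + 3 * z))"
    unfolding sum_summand_recurrence[of z] by (simp add: algebra_simps)
  also have "h ^ (6 * z + 3) * (h ^ 2 * (\<Sum>j<z. summand (z - 1) j)) =
     (\<Sum>k<2 * z. h ^ (3 * (Suc z) ^ 2 - k * (k + 1) div 2))"
    unfolding IH unfolding sum_distrib_left by (intro sum.cong) (auto simp only: sh lessThan_iff)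
  also have "h ^ 2 * ((1 + h ^ (2 * z + 1)) * h ^ (z * z + 3 * z)) =
      h ^ (z * z + 5 * z + 3) + h ^ (z * z + 3 * z + 2)"
    by (simp add: algebra_simps power_add[symmetric] numeral_eq_Suc)
  also have "z * z + 5 * z + 3 = 3 * (Suc z) ^ 2 - (2 * z) * (2 * z + 1) div 2"
    by (simp add: power2_eq_square algebra_simps)
  also have "z * z + 3 * z + 2 = 3 * (Suc z) ^ 2 - (2 * z + 1) * (2 * z + 1 + 1) div 2"
    by (simp add: power2_eq_square algebra_simps)
  finally show ?case
    unfolding z_def[symmetric] by (simp add: algebra_simps)
qed

text \<open>Putting m = r - j turns the triangle j \<le> r < M into Lebesgue sums of d = M - j
  terms. Their error has order d(d+1), and 2(j+1) + d(d+1) is at least 2j + 2d = 2M.\<close>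

lemma hecke_identity_truncated:
  "h ^ (2 * M) dvd
     (\<Sum>j<M. (- 1) ^ j * h ^ (2 * (j + 1)) * (\<Prod>i<j. 1 - h ^ (4 * Suc i)) * e (Suc j))
     - (\<Sum>r<M. \<Sum>k<2 * Suc r. h ^ (3 * (Suc r) ^ 2 - k * (k + 1) div 2))"
proof -
  let ?P = "\<lambda>j. \<Prod>i<j. 1 - h ^ (4 * Suc i)"
  let ?c = "\<lambda>j. (- 1) ^ j * h ^ (2 * (j + 1)) * e (Suc j)"
  have "(\<Sum>r<M. \<Sum>k<2 * Suc r. h ^ (3 * (Suc r) ^ 2 - k * (k + 1) div 2)) =
     (\<Sum>r<M. \<Sum>j\<le>r. h ^ 2 * summand r j)"
    unfolding hecke_term[symmetric] sum_distrib_left ..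
  also have "\<dots> = (\<Sum>(r, j)\<in>Sigma {..<M} (\<lambda>r. {..r}). h ^ 2 * summand r j)"
    by (subst sum.Sigma) auto
  also have "\<dots> = (\<Sum>(j, m)\<in>Sigma {..<M} (\<lambda>j. {..<M - j}). h ^ 2 * summand (j + m) j)"
    by (rule sum.reindex_bij_witness[of _ "\<lambda>(j, m). (j + m, j)" "\<lambda>(r, j). (j, r - j)"]) auto
  also have "\<dots> = (\<Sum>j<M. \<Sum>m<M - j. h ^ 2 * summand (j + m) j)"
    by (subst sum.Sigma) auto
  also have "\<dots> = (\<Sum>j<M. ?c j * (\<Sum>m<M - j. lebesgue_term h j m))"
    unfolding sum_distrib_left by (intro sum.cong) (auto simp: summand_def power2_eq_square algebra_simps)
  finally have eq: "(\<Sum>j<M. (- 1) ^ j * h ^ (2 * (j + 1)) * ?P j * e (Suc j))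
     - (\<Sum>r<M. \<Sum>k<2 * Suc r. h ^ (3 * (Suc r) ^ 2 - k * (k + 1) div 2)) =
     (\<Sum>j<M. ?c j * (?P j - (\<Sum>m<M - j. lebesgue_term h j m)))"
    by (simp add: sum_subtractf algebra_simps)
  show ?thesis
    unfolding eq
  proof (rule dvd_sum)
    fix j assume "j \<in> {..<M}"
    then obtain m where m: "M = j + Suc m" using less_imp_Suc_add by auto
    have "h ^ (2 * M) dvd h ^ (2 * (j + 1)) * h ^ ((M - j) * (M - j + 1))"
      unfolding power_add[symmetric] by (rule le_imp_power_dvd) (simp add: m algebra_simps)
    moreover have "\<dots> dvd h ^ (2 * (j + 1)) * (?P j - (\<Sum>m<M - j. lebesgue_term h j m))"
      by (intro mult_dvd_mono lebesgue_truncated dvd_refl)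
    ultimately have "h ^ (2 * M) dvd h ^ (2 * (j + 1)) * (?P j - (\<Sum>m<M - j. lebesgue_term h j m))"
      by (rule dvd_trans)
    then have "h ^ (2 * M) dvd ((- 1) ^ j * e (Suc j)) * (h ^ (2 * (j + 1)) * (?P j - (\<Sum>m<M - j. lebesgue_term h j m)))"
      by (rule dvd_mult)
    then show "h ^ (2 * M) dvd ?c j * (?P j - (\<Sum>m<M - j. lebesgue_term h j m))"
      by (simp only: mult_ac)
  qed
qed

end

section \<open>The coefficients of the series\<close>

text \<open>Once the lower coefficients vanish, dividing by x^n leaves a power series with value
  \<open>a n\<close> at 0, while the bound leaves a positive power of |x| and forces the limit
  0.\<close>

lemma power_series_coeff_eq_0:
  fixes a :: "nat \<Rightarrow> 'a::{real_normed_field, banach}"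
  assumes s: "0 < s" and sums: "\<And>x. norm x < s \<Longrightarrow> (\<lambda>n. a n * x ^ n) sums f x"
    and bound: "\<And>x. norm x < s \<Longrightarrow> norm (f x) \<le> C * norm x ^ N"
    and "n < N"
  shows "a n = 0"
  using \<open>n < N\<close>
proof (induction n rule: less_induct)
  case (less n)
  define g where "g x = (if x = 0 then a n else f x / x ^ n)" for x
  have "(\<lambda>k. a (k + n) * x ^ k) sums g x" if x: "norm x < s" for x
  proof (cases "x = 0")
    case True
    then show ?thesis using powser_sums_zero[of "\<lambda>k. a (k + n)"] by (simp add: g_def)
  next
    case False
    have "(\<Sum>k<n. a k * x ^ k) = 0" using less by (intro sum.neutral) auto
    then have "(\<lambda>k. a (k + n) * x ^ (k + n)) sums f x"
      using sums_split_initial_segment[OF sums[OF x], of n] by simp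
    then have "(\<lambda>k. a (k + n) * x ^ (k + n) / x ^ n) sums (f x / x ^ n)"
      by (rule sums_divide)
    then show ?thesis using False by (simp add: g_def power_add)
  qed
  then have "(g \<longlongrightarrow> a (0 + n)) (at 0)" by (rule powser_limit_0[OF s])
  moreover have "(g \<longlongrightarrow> 0) (at 0)"
  proof (rule Lim_null_comparison)
    have "\<forall>\<^sub>F x in at (0::'a). norm x < s"
      unfolding eventually_at using s by auto
    then show "\<forall>\<^sub>F x in at 0. norm (g x) \<le> C * norm x ^ (N - n)"
    proof (rule eventually_mono[OF eventually_conj[OF _ eventually_neq_at_within[of 0]]], safe)
      fix x :: 'a assume x: "norm x < s" "x \<noteq> 0"
      have "norm (g x) = norm (f x) / norm x ^ n" using x by (simp add: g_def norm_divide norm_power)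
      also have "\<dots> \<le> C * norm x ^ N / norm x ^ n"
        using bound[OF x(1)] by (intro divide_right_mono) auto
      also have "\<dots> = C * norm x ^ (N - n)" using x less.prems by (simp add: power_diff)
      finally show "norm (g x) \<le> C * norm x ^ (N - n)" .
    qed
    have "((\<lambda>x::'a. C * norm x ^ (N - n)) \<longlongrightarrow> C * norm (0::'a) ^ (N - n)) (at 0)"
      by (intro tendsto_intros)
    then show "((\<lambda>x::'a. C * norm x ^ (N - n)) \<longlongrightarrow> 0) (at 0)"
      using less.prems by (simp add: power_0_left)
  qed
  ultimately show ?case using LIM_unique by fastforce
qed

section \<open>The summands as integer power series\<close>

definition geometric_fps :: "nat \<Rightarrow> int fps" where
  "geometric_fps m = Abs_fps (\<lambda>k. if m dvd k then 1 else 0)"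

lemma geometric_fps_inverse:
  assumes "m > 0"
  shows "geometric_fps m * (1 - fps_X ^ m) = 1"
proof (rule fps_ext)
  fix k
  have "m dvd k \<longleftrightarrow> m dvd (k - m)" if "k \<ge> m" using that by (simp add: dvd_minus_self)
  then show "fps_nth (geometric_fps m * (1 - fps_X ^ m)) k = fps_nth 1 k"
    using assms by (auto simp: geometric_fps_def right_diff_distrib fps_X_power_mult_right_nth
      dest: dvd_imp_le intro: Nat.gr0I)
qed

definition inv_odd :: "nat \<Rightarrow> int fps" where
  "inv_odd j = (\<Prod>i<j. geometric_fps (2 * i + 1))"

definition u2_fps :: "nat \<Rightarrow> int fps" where
  "u2_fps j = fps_X ^ (2 * (j + 1)) * (\<Prod>i<j. (1 + fps_X ^ (2 * Suc i)) ^ 2) * inv_odd (Suc j)"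

text \<open>Links an analytic function to an integer power series, where reduction modulo 2 makes
  sense. The coefficients pass through the naturals so that the rules for
  \<open>nat_expansion\<close> apply.\<close>

definition expands :: "(complex \<Rightarrow> complex) \<Rightarrow> int fps \<Rightarrow> bool" where
  "expands f F \<longleftrightarrow> (\<exists>a. nat_expansion f a \<and> F = Abs_fps (\<lambda>k. int (a k)))"

lemma expands_mult: "expands f F \<Longrightarrow> expands g G \<Longrightarrow> expands (\<lambda>q. f q * g q) (F * G)"
  unfolding expands_def using nat_expansion_mult
  by (fastforce simp: fps_eq_iff fps_mult_nth atLeast0AtMost)

lemma expands_add: "expands f F \<Longrightarrow> expands g G \<Longrightarrow> expands (\<lambda>q. f q + g q) (F + G)"
  unfolding expands_def using nat_expansion_add by (fastforce simp: fps_eq_iff)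

lemma expands_power: "expands (\<lambda>q. q ^ m) (fps_X ^ m)"
  unfolding expands_def using nat_expansion_power[of m]
  by (intro exI[of _ "\<lambda>k. if k = m then 1 else 0"]) (auto simp: fps_eq_iff)

lemma expands_geometric: "m > 0 \<Longrightarrow> expands (\<lambda>q. 1 / (1 - q ^ m)) (geometric_fps m)"
  unfolding expands_def using nat_expansion_geometric[of m]
  by (intro exI[of _ "\<lambda>k. if m dvd k then 1 else 0"]) (auto simp: fps_eq_iff geometric_fps_def)

lemma expands_u2_term: "expands (u2_term n) (u2_fps n)"
proof (induction n)
  case 0
  have "u2_fps 0 = fps_X ^ 2 * geometric_fps 1" by (simp add: u2_fps_def inv_odd_def)
  then show ?case
    using expands_mult[OF expands_power[of 2] expands_geometric[of 1]]
    unfolding u2_term_0[abs_def] by simp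
next
  case (Suc n)
  have "u2_fps (Suc n) = u2_fps n * (fps_X ^ 2 * ((fps_X ^ 0 + fps_X ^ (2 * n + 2)) *
      (fps_X ^ 0 + fps_X ^ (2 * n + 2))) * geometric_fps (2 * n + 3))"
    unfolding u2_fps_def inv_odd_def prod.lessThan_Suc
    by (simp add: power2_eq_square mult_ac power_add numeral_3_eq_3)
  moreover have "2 * n + 3 > 0" by simp
  note expands_mult[OF Suc expands_mult[OF expands_mult[OF expands_power[of 2]
      expands_mult[OF expands_add[OF expands_power[of 0] expands_power[of "2 * n + 2"]]
      expands_add[OF expands_power[of 0] expands_power[of "2 * n + 2"]]]] expands_geometric[OF this]]]
  ultimately show ?case unfolding u2_term_Suc[abs_def] by simp
qed

lemma u2_term_sums:
  assumes "norm q < 1"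
  shows "(\<lambda>k. of_int (fps_nth (u2_fps n) k) * q ^ k) sums u2_term n q"
proof -
  obtain a where a: "nat_expansion (u2_term n) a" "u2_fps n = Abs_fps (\<lambda>k. int (a k))"
    using expands_u2_term unfolding expands_def by blast
  then show ?thesis using assms unfolding nat_expansion_def by simp
qed

text \<open>On this disc the ratio of consecutive terms is at most |q|^2 (1 + 1/4)^2 / (1 - 1/8) =
  (25/14) |q|^2, which is below 2 |q|^2.\<close>

lemma norm_u2_term_le:
  assumes q: "norm q \<le> 1 / 2"
  shows "norm (u2_term n q) \<le> 2 * norm q ^ 2 * (2 * norm q ^ 2) ^ n"
proof -
  have pw: "norm q ^ k \<le> (1 / 2) ^ k" for k using q by (intro power_mono) auto
  have den: "norm (1 / (1 - q ^ k)) \<le> 1 / (1 - (1 / 2) ^ k)" if "k > 0" for k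
  proof -
    have "(1 / 2) ^ k < (1::real)" using that by (simp add: power_less_one_iff)
    moreover have "norm (1 - q ^ k) \<ge> 1 - norm q ^ k"
      using norm_triangle_ineq2[of 1 "q ^ k"] by (simp add: norm_power)
    then have "norm (1 - q ^ k) \<ge> 1 - (1 / 2) ^ k" using pw[of k] by linarith
    ultimately show ?thesis by (simp add: norm_divide frac_le)
  qed
  show ?thesis
  proof (induction n)
    case 0
    have "norm (u2_term 0 q) = norm q ^ 2 * norm (1 / (1 - q ^ 1))"
      unfolding u2_term_0 norm_mult norm_power ..
    also have "\<dots> \<le> norm q ^ 2 * 2" using den[of 1] by (intro mult_left_mono) auto
    finally show ?case by simp
  next
    case (Suc n)
    have half: "(1 / 2) ^ (2 * n + k) \<le> (1 / 2 :: real) ^ k" for k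
      by (rule power_decreasing) auto
    have "norm (1 + q ^ (2 * n + 2)) \<le> 1 + norm q ^ (2 * n + 2)"
      using norm_triangle_ineq[of 1 "q ^ (2 * n + 2)"] by (simp only: norm_power norm_one)
    also have "\<dots> \<le> 5 / 4" using pw[of "2 * n + 2"] half[of 2] by (simp add: power2_eq_square)
    finally have a: "norm (1 + q ^ (2 * n + 2)) \<le> 5 / 4" .
    have "norm (1 / (1 - q ^ (2 * n + 3))) \<le> 1 / (1 - (1 / 2) ^ (2 * n + 3))" by (rule den) simp
    also have "\<dots> \<le> 1 / (1 - (1 / 2) ^ 3)" using half[of 3] by (intro divide_left_mono) (auto simp: eval_nat_numeral)
    also have "\<dots> = 8 / 7" by (simp add: eval_nat_numeral)
    finally have b: "norm (1 / (1 - q ^ (2 * n + 3))) \<le> 8 / 7" .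
    have "norm (u2_term (Suc n) q) = norm (u2_term n q) * norm q ^ 2 *
        ((norm (1 + q ^ (2 * n + 2)) * norm (1 + q ^ (2 * n + 2))) * norm (1 / (1 - q ^ (2 * n + 3))))"
      unfolding u2_term_Suc by (simp only: norm_mult norm_power power_0 mult.assoc)
    also have "\<dots> \<le> (2 * norm q ^ 2 * (2 * norm q ^ 2) ^ n) * norm q ^ 2 * ((5 / 4 * (5 / 4)) * (8 / 7))"
      by (intro mult_mono Suc a b) (auto intro!: mult_nonneg_nonneg)
    also have "\<dots> = 2 * norm q ^ 2 * (2 * norm q ^ 2) ^ n * norm q ^ 2 * (25 / 14)" by simp
    also have "\<dots> \<le> 2 * norm q ^ 2 * (2 * norm q ^ 2) ^ n * norm q ^ 2 * 2"
      by (intro mult_left_mono) auto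
    finally show ?case by (simp add: mult_ac)
  qed
qed

text \<open>The tail is dominated by a geometric series of ratio 2 |q|^2 \<le> 1/2. What matters is
  the order of vanishing 2K + 2 at 0.\<close>

lemma norm_u2_series_tail_le:
  assumes q: "norm q \<le> 1 / 2"
  shows "norm (u2_series q - (\<Sum>n<K. u2_term n q)) \<le> 4 * 2 ^ K * norm q ^ (2 * K + 2)"
proof -
  define t where "t = 2 * norm q ^ 2"
  have "norm q ^ 2 \<le> (1 / 2) ^ 2" using q by (intro power_mono) auto
  then have t: "0 \<le> t" "t \<le> 1 / 2" by (auto simp: t_def power2_eq_square)
  have s: "summable (\<lambda>n. norm (u2_term n q))" using q by (intro summable_norm_u2_term) auto
  have "u2_series q = (\<Sum>n. u2_term n q)" by (simp add: u2_series_def u2_term_def)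
  then have eq: "u2_series q - (\<Sum>n<K. u2_term n q) = (\<Sum>n. u2_term (n + K) q)"
    using suminf_minus_initial_segment[OF summable_norm_cancel[OF s], of K] by simp
  have s': "summable (\<lambda>n. norm (u2_term (n + K) q))" using s by (subst summable_iff_shift)
  have g: "(\<lambda>n. t * t ^ K * t ^ n) sums (t * t ^ K * (1 / (1 - t)))"
    using t by (intro sums_mult geometric_sums) auto
  have "norm (\<Sum>n. u2_term (n + K) q) \<le> (\<Sum>n. norm (u2_term (n + K) q))"
    by (rule summable_norm[OF s'])
  also have "\<dots> \<le> (\<Sum>n. t * t ^ K * t ^ n)"
  proof (rule suminf_le[OF _ s' sums_summable[OF g]])
    show "norm (u2_term (n + K) q) \<le> t * t ^ K * t ^ n" for n
      using norm_u2_term_le[OF q, of "n + K"] by (simp add: t_def power_add mult_ac)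
  qed
  also have "\<dots> = t * t ^ K * (1 / (1 - t))" using sums_unique[OF g] by simp
  also have "\<dots> \<le> t * t ^ K * 2" using t by (intro mult_left_mono) (auto simp: field_simps)
  also have "\<dots> = 4 * 2 ^ K * norm q ^ (2 * K + 2)"
    by (simp add: t_def power_mult_distrib power_mult power_add) (simp add: power2_eq_square)
  finally show ?thesis unfolding eq .
qed

text \<open>The tail after \<open>K\<close> summands is O(q^(2K+2)) and cannot reach this
  coefficient. From here on \<open>u2\<close> is accessible by formal power series alone.\<close>

lemma u2_eq_coeff:
  assumes "n < 2 * K + 2"
  shows "u2 n = fps_nth (\<Sum>j<K. u2_fps j) n"
proof -
  have "complex_of_int (u2 n - (\<Sum>j<K. fps_nth (u2_fps j) n)) = 0"
  proof (rule power_series_coeff_eq_0[of "1 / 2" "\<lambda>n. complex_of_int (u2 n - (\<Sum>j<K. fps_nth (u2_fps j) n))"])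
    fix q :: complex assume q: "norm q < 1 / 2"
    then have "(\<lambda>n. of_int (u2 n) * q ^ n - (\<Sum>j<K. of_int (fps_nth (u2_fps j) n) * q ^ n)) sums
        (u2_series q - (\<Sum>j<K. u2_term j q))"
      by (intro sums_diff sums_sum u2_sums u2_term_sums) auto
    then show "(\<lambda>n. of_int (u2 n - (\<Sum>j<K. fps_nth (u2_fps j) n)) * q ^ n) sums
        (u2_series q - (\<Sum>j<K. u2_term j q))"
      by (simp add: left_diff_distrib sum_distrib_right)
    show "norm (u2_series q - (\<Sum>j<K. u2_term j q)) \<le> 4 * 2 ^ K * norm q ^ (2 * K + 2)"
      using q by (intro norm_u2_series_tail_le) auto
  qed (use assms in auto)
  then show ?thesis by (simp add: fps_sum_nth del: of_int_diff of_int_sum)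
qed

section \<open>Parity and an indefinite quadratic form\<close>

lemma dvd_prod_diff:
  fixes f g :: "'b \<Rightarrow> 'a::comm_ring_1"
  assumes "\<And>i. i \<in> A \<Longrightarrow> c dvd f i - g i"
  shows "c dvd prod f A - prod g A"
  using assms
proof (induction A rule: infinite_finite_induct)
  case (insert x A)
  have "prod f (insert x A) - prod g (insert x A) =
      (f x - g x) * prod f A + g x * (prod f A - prod g A)"
    using insert by (simp add: algebra_simps)
  then show ?case using insert by (metis dvd_add dvd_mult dvd_mult2 insertCI)
qed auto

interpretation u2: inverse_odd_products "fps_X :: int fps" inv_odd
proof
  show "inv_odd 0 = 1" by (simp add: inv_odd_def)
  show "inv_odd (Suc j) * (1 - fps_X ^ (2 * j + 1)) = inv_odd j" for j
    using geometric_fps_inverse[of "2 * j + 1"] by (simp add: inv_odd_def mult.assoc)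
qed

text \<open>(1 + y)^2 and 1 - y^2 differ by 2(y + y^2), here with y = X^(2i+2). The sign (-1)^j,
  invisible modulo 2, is inserted to fit the Hecke-type identity.\<close>

lemma u2_fps_cong:
  "2 dvd u2_fps j - (- 1) ^ j * fps_X ^ (2 * (j + 1)) * (\<Prod>i<j. 1 - fps_X ^ (4 * Suc i)) * inv_odd (Suc j)"
proof -
  have "2 dvd (\<Prod>i<j. (1 + fps_X ^ (2 * Suc i)) ^ 2 :: int fps) - (\<Prod>i<j. 1 - fps_X ^ (4 * Suc i))"
  proof (rule dvd_prod_diff)
    fix i
    have "4 * Suc i = 2 * Suc i + 2 * Suc i" by simp
    then have "(fps_X :: int fps) ^ (4 * Suc i) = fps_X ^ (2 * Suc i) * fps_X ^ (2 * Suc i)"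
      by (simp only: power_add)
    moreover have "(2 :: int fps) dvd (1 + y) ^ 2 - (1 - y * y)" for y
    proof
      show "(1 + y) ^ 2 - (1 - y * y) = 2 * (y + y * y)"
        by (simp add: power2_eq_square algebra_simps)
    qed
    ultimately show "(2 :: int fps) dvd (1 + fps_X ^ (2 * Suc i)) ^ 2 - (1 - fps_X ^ (4 * Suc i))"
      by metis
  qed
  moreover have "(2 :: int fps) dvd 1 - (- 1) ^ j" by (cases "even j") auto
  ultimately have "2 dvd fps_X ^ (2 * (j + 1)) * inv_odd (Suc j) *
      ((\<Prod>i<j. (1 + fps_X ^ (2 * Suc i)) ^ 2) - (\<Prod>i<j. 1 - fps_X ^ (4 * Suc i))
       + (1 - (- 1) ^ j) * (\<Prod>i<j. 1 - fps_X ^ (4 * Suc i)))"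
    by (intro dvd_mult dvd_add dvd_mult2)
  then show ?thesis unfolding u2_fps_def by (simp add: algebra_simps)
qed

text \<open>Two errors are combined, a multiple of 2 and a multiple of X^(2M); neither affects the
  parity of a coefficient below 2M.\<close>

lemma even_u2_minus:
  assumes "n < 2 * M"
  shows "even (u2 n - fps_nth (\<Sum>r<M. \<Sum>k<2 * Suc r. fps_X ^ (3 * (Suc r) ^ 2 - k * (k + 1) div 2)) n)"
proof -
  let ?H = "\<Sum>j<M. (- 1) ^ j * fps_X ^ (2 * (j + 1)) * (\<Prod>i<j. 1 - fps_X ^ (4 * Suc i)) * inv_odd (Suc j)"
  let ?T = "\<Sum>r<M. \<Sum>k<2 * Suc r. fps_X ^ (3 * (Suc r) ^ 2 - k * (k + 1) div 2) :: int fps"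
  have "2 dvd (\<Sum>j<M. u2_fps j) - ?H"
    unfolding sum_subtractf[symmetric] by (rule dvd_sum) (rule u2_fps_cong)
  then obtain A where A: "(\<Sum>j<M. u2_fps j) - ?H = 2 * A" by (elim dvdE)
  obtain B where B: "?H - ?T = fps_X ^ (2 * M) * B"
    using u2.hecke_identity_truncated[of M] by (elim dvdE)
  have "(\<Sum>j<M. u2_fps j) - ?T = 2 * A + fps_X ^ (2 * M) * B" using A B by (simp add: algebra_simps)
  then have "fps_nth (\<Sum>j<M. u2_fps j) n - fps_nth ?T n = fps_nth (2 * A + fps_X ^ (2 * M) * B) n"
    by (simp only: fps_sub_nth[symmetric])
  also have "\<dots> = 2 * fps_nth A n"
    using assms by (simp add: fps_X_power_mult_nth numeral_fps_const)
  finally have "fps_nth (\<Sum>j<M. u2_fps j) n - fps_nth ?T n = 2 * fps_nth A n" .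
  moreover have "u2 n = fps_nth (\<Sum>j<M. u2_fps j) n" using assms by (intro u2_eq_coeff) auto
  ultimately show ?thesis by simp
qed

text \<open>The condition x < 2y is k < 2z under x = 2k + 1, y = 2z. It describes solutions reduced
  with respect to the units 5 + 2 sqrt 6 and 5 - 2 sqrt 6.\<close>

definition norm_sols :: "int \<Rightarrow> (int \<times> int) set" where
  "norm_sols N = {(x, y). 0 < x \<and> x < 2 * y \<and> 6 * y ^ 2 - x ^ 2 = N}"

text \<open>An even x makes N even, and odd x, y give N = 5 modulo 8. Hence every solution has the
  shape x = 2k + 1, y = 2z.\<close>

lemma norm_form_parity:
  fixes x y :: int
  assumes "6 * y ^ 2 - x ^ 2 = N" "N mod 8 = 7"
  shows "odd x" and "even y"
proof -
  show odd: "odd x"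
  proof
    assume "even x"
    then have "even (6 * y ^ 2 - x ^ 2)" by simp
    then show False using assms by presburger
  qed
  show "even y"
  proof (rule ccontr)
    assume "odd y"
    then obtain a b where "x = 2 * a + 1" "y = 2 * b + 1" using odd by (auto elim!: oddE)
    then have "N = 5 + 24 * (b * (b + 1)) - 4 * (a * (a + 1))"
      using assms by (simp add: power2_eq_square algebra_simps)
    moreover have "even (b * (b + 1))" "even (a * (a + 1))" by simp_all
    then obtain u v where "b * (b + 1) = 2 * u" "a * (a + 1) = 2 * v" by (meson evenE)
    ultimately have "N = 5 + 8 * (6 * u - v)" by simp
    then show False using assms(2) by presburger
  qed
qed

text \<open>Multiplying n = 3z^2 - k(k+1)/2 by 8 and completing the square gives 6(2z)^2 - (2k+1)^2
  = 8n - 1, where z = r + 1.\<close>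

lemma odd_u2_iff_card_norm_sols: "odd (u2 n) \<longleftrightarrow> odd (card (norm_sols (8 * int n - 1)))"
proof -
  define M where "M = Suc n"
  define S where "S = Sigma {..<M} (\<lambda>r. {..<2 * Suc r})"
  define e where "e = (\<lambda>(r, k). 3 * (Suc r) ^ 2 - k * (k + 1) div 2)"
  have mod8: "(8 * int n - 1) mod 8 = 7" by presburger
  have fin: "finite S" by (simp add: S_def)
  have tri: "2 * (k * (k + 1) div 2) = k * (k + 1)" for k :: nat by simp
  \<comment> \<open>The slack z^2 + z makes the subtraction in the exponent exact and bounds z by n,
    so that r < Suc n covers all solutions.\<close>
  have le: "k * (k + 1) div 2 + z ^ 2 + z \<le> 3 * z ^ 2" if "k < 2 * z" for k z :: nat
  proof -
    have "k * (k + 1) \<le> (2 * z - 1) * (2 * z)" using that by (intro mult_mono) auto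
    also have "\<dots> = 4 * z ^ 2 - 2 * z" by (simp add: algebra_simps power2_eq_square)
    finally have "2 * (k * (k + 1) div 2) \<le> 4 * z ^ 2 - 2 * z" unfolding tri .
    moreover have "z \<le> z ^ 2" by (simp add: power2_eq_square)
    ultimately show ?thesis by linarith
  qed
  have rel: "e (r, k) = n \<longleftrightarrow> 6 * (2 * (int r + 1)) ^ 2 - (2 * int k + 1) ^ 2 = 8 * int n - 1"
    if "k < 2 * Suc r" for r k
  proof -
    have "e (r, k) = n \<longleftrightarrow> 3 * (Suc r) ^ 2 = n + k * (k + 1) div 2"
      using le[OF that] by (auto simp: e_def)
    also have "\<dots> \<longleftrightarrow> 24 * (Suc r) ^ 2 = 8 * n + 4 * (k * (k + 1))"
      using tri[of k] by linarith
    also have "\<dots> \<longleftrightarrow> int (24 * (Suc r) ^ 2) = int (8 * n + 4 * (k * (k + 1)))"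
      by (rule of_nat_eq_iff[symmetric])
    also have "\<dots> \<longleftrightarrow> 6 * (2 * (int r + 1)) ^ 2 - (2 * int k + 1) ^ 2 = 8 * int n - 1"
      by (auto simp: power2_eq_square algebra_simps)
    finally show ?thesis .
  qed
  have "fps_nth (\<Sum>r<M. \<Sum>k<2 * Suc r. fps_X ^ (3 * (Suc r) ^ 2 - k * (k + 1) div 2) :: int fps) n
      = (\<Sum>p\<in>S. if e p = n then 1 else 0)"
    unfolding S_def by (subst sum.Sigma) (auto simp: fps_sum_nth e_def case_prod_unfold intro!: sum.cong)
  also have "\<dots> = int (card {p \<in> S. e p = n})"
    using fin by (simp add: sum.If_cases Int_def)
  also have "card {p \<in> S. e p = n} = card (norm_sols (8 * int n - 1))"
  proof (rule bij_betw_same_card[OF bij_betw_byWitness[where f = "\<lambda>(r, k). (2 * int k + 1, 2 * (int r + 1))"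
        and f' = "\<lambda>(x, y). (nat (y div 2) - 1, nat (x div 2))"]], goal_cases)
    case 1
    show ?case by auto
  next
    case 2
    show ?case
    proof
      fix p assume p: "p \<in> norm_sols (8 * int n - 1)"
      obtain x y where xy: "p = (x, y)" by (cases p)
      have *: "0 < x" "x < 2 * y" "6 * y ^ 2 - x ^ 2 = 8 * int n - 1" using p by (auto simp: norm_sols_def xy)
      have "odd x" "even y" using norm_form_parity[OF *(3) mod8] by auto
      then show "(case (case p of (x, y) \<Rightarrow> (nat (y div 2) - 1, nat (x div 2))) of
          (r, k) \<Rightarrow> (2 * int k + 1, 2 * (int r + 1))) = p"
        using * by (auto simp: xy elim!: oddE evenE)
    qed
  next
    case 3
    show ?case using rel by (auto simp: S_def norm_sols_def)
  next
    case 4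
    show ?case
    proof safe
      fix x y assume "(x, y) \<in> norm_sols (8 * int n - 1)"
      then have *: "0 < x" "x < 2 * y" "6 * y ^ 2 - x ^ 2 = 8 * int n - 1" by (auto simp: norm_sols_def)
      have "odd x" "even y" using norm_form_parity[OF *(3) mod8] by auto
      then obtain a b where ab: "x = 2 * a + 1" "y = 2 * b" by (auto elim!: oddE evenE)
      have "a \<ge> 0" "b \<ge> 1" using * ab by auto
      define k where "k = nat a"
      define r where "r = nat b - 1"
      have kr: "a = int k" "b = int r + 1" using \<open>a \<ge> 0\<close> \<open>b \<ge> 1\<close> by (auto simp: k_def r_def)
      have k: "k < 2 * Suc r" using * ab kr by auto
      have e: "e (r, k) = n" using rel[OF k] *(3) ab kr by simp
      have "Suc r \<le> n" using le[OF k] e unfolding e_def by simp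
      then have "r < M" by (simp add: M_def)
      then have "(r, k) \<in> S" using k by (simp add: S_def)
      moreover have "nat (y div 2) - 1 = r" "nat (x div 2) = k" using ab kr by auto
      ultimately show "(nat (y div 2) - 1, nat (x div 2)) \<in> S" "e (nat (y div 2) - 1, nat (x div 2)) = n"
        using e by auto
    qed
  qed
  finally show ?thesis
    using even_u2_minus[of n M] by (simp add: M_def del: sum.lessThan_Suc)
qed

section \<open>Primitive solutions and square roots of 6\<close>

definition sqrt6_roots :: "int \<Rightarrow> int set" where
  "sqrt6_roots M = {t. 0 \<le> t \<and> t < M \<and> M dvd t ^ 2 - 6}"

definition primitive_sols :: "int \<Rightarrow> (int \<times> int) set" where
  "primitive_sols M = {(x, y). \<bar>x\<bar> < 2 * y \<and> 6 * y ^ 2 - x ^ 2 = M \<and> coprime x y}"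

section \<open>Existence and uniqueness of the reduced solution for a root\<close>

lemma thue:
  fixes a b M t :: int
  assumes M: "M > 0" and ab: "a > 0" "b > 0" "a * b > M"
  obtains x y where "(x, y) \<noteq> (0, 0)" "\<bar>x\<bar> < a" "\<bar>y\<bar> < b" "M dvd x - t * y"
proof -
  \<comment> \<open>Pigeonhole: the a b pairs outnumber the M residues, and the difference of two
    colliding pairs is the required vector.\<close>
  define f where "f = (\<lambda>(i, j). (i - t * j) mod M)"
  have "f ` ({0..<a} \<times> {0..<b}) \<subseteq> {0..<M}" using M by (auto simp: f_def)
  then have "card (f ` ({0..<a} \<times> {0..<b})) \<le> card {0..<M}" by (intro card_mono) auto
  also have "\<dots> < card ({0..<a} \<times> {0..<b})"
    using assms by (simp add: card_cartesian_product nat_mult_distrib[symmetric])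
  finally have "\<not> inj_on f ({0..<a} \<times> {0..<b})" by (rule pigeonhole)
  then obtain i j i' j' where ij: "i \<in> {0..<a}" "i' \<in> {0..<a}" "j \<in> {0..<b}" "j' \<in> {0..<b}"
    "(i, j) \<noteq> (i', j')" "(i - t * j) mod M = (i' - t * j') mod M"
    unfolding inj_on_def f_def by auto
  have "M dvd (i - t * j) - (i' - t * j')" using ij(6) by (simp add: mod_eq_dvd_iff)
  then have "M dvd (i - i') - t * (j - j')" by (simp add: algebra_simps)
  then show ?thesis using ij by (intro that[of "i - i'" "j - j'"]) auto
qed

text \<open>\<open>a\<close> is the square root of K / c rounded up; it supplies integer side
  lengths for the box in Thue's lemma.\<close>

lemma exists_sqrt_bound:
  fixes c K :: int
  assumes "c > 0" "K > 0"
  obtains a where "a > 0" "c * (a - 1) ^ 2 < K" "K \<le> c * a ^ 2"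
proof -
  define P where "P n \<longleftrightarrow> K \<le> c * int n ^ 2" for n
  have "K * 1 \<le> K * K * c" using assms by (simp add: mult_le_cancel_left1 int_one_le_iff_zero_less)
  then have "P (nat K)" using assms by (simp add: P_def power2_eq_square mult_ac)
  then have P: "P (LEAST n. P n)" by (rule LeastI)
  define m where "m = (LEAST n. P n)"
  have "\<not> P 0" using assms by (simp add: P_def)
  then have "m > 0" using P unfolding m_def by (metis gr0I)
  then have "\<not> P (m - 1)" unfolding m_def by (intro not_less_Least) simp
  then show ?thesis
    using P \<open>m > 0\<close> unfolding m_def[symmetric]
    by (intro that[of "int m"]) (auto simp: P_def of_nat_diff)
qed

text \<open>Irrationality of sqrt 6: the exponent of 3 would be even on the left and odd on the
  right.\<close>

lemma square_eq_6_square: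
  fixes x y :: int
  assumes "x ^ 2 = 6 * y ^ 2"
  shows "x = 0 \<and> y = 0"
proof (rule ccontr)
  assume "\<not> (x = 0 \<and> y = 0)"
  then have nz: "x \<noteq> 0" "y \<noteq> 0" using assms by auto
  have "prime (3 :: int)" by simp
  then have "multiplicity 3 (x ^ 2) = 2 * multiplicity 3 x" "multiplicity 3 (y ^ 2) = 2 * multiplicity 3 y"
    using nz by (simp_all add: prime_elem_multiplicity_power_distrib)
  moreover have "multiplicity 3 (6 * y ^ 2) = multiplicity 3 (6 :: int) + multiplicity 3 (y ^ 2)"
    using nz by (intro prime_elem_multiplicity_mult_distrib) auto
  moreover have "multiplicity 3 (6 :: int) = 1"
    by (rule multiplicity_eqI) auto
  ultimately have "2 * multiplicity 3 x = 1 + 2 * multiplicity 3 y" using assms by simp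
  then show False by presburger
qed

lemma square_mod_8: "(x :: int) ^ 2 mod 8 = 0 \<or> x ^ 2 mod 8 = 1 \<or> x ^ 2 mod 8 = 4"
proof -
  have "x mod 8 \<in> {0, 1, 2, 3, 4, 5, 6, 7}" by auto
  then show ?thesis by (auto simp: power2_eq_square mod_mult_eq[of x 8 x, symmetric])
qed

text \<open>Thue's lemma gives a small element of the lattice \<open>x \<equiv> t y\<close> whose norm is \<open>k M\<close> with
  \<open>\<bar>k\<bar> \<le> 2\<close>; modulo 8 only \<open>k = -1\<close> and \<open>k = 2\<close> survive, and in the latter case one divides by
  \<open>2 + \<surd>6\<close>, an element of norm \<open>-2\<close>.\<close>
lemma norm_form_represents:
  fixes M t :: int
  assumes M: "M > 0" "M mod 8 = 7" and t: "M dvd t ^ 2 - 6"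
  obtains x y where "6 * y ^ 2 - x ^ 2 = M" "M dvd x - t * y"
proof -
  \<comment> \<open>A box of about sqrt(3M) by sqrt(M/2) has area at least sqrt(3/2) M > M, while
    x^2 and 6y^2 both stay below 3M.\<close>
  obtain a where a: "a > 0" "(a - 1) ^ 2 < 3 * M" "3 * M \<le> a ^ 2"
    using exists_sqrt_bound[of 1 "3 * M"] M by auto
  obtain b where b: "b > 0" "2 * (b - 1) ^ 2 < M" "M \<le> 2 * b ^ 2"
    using exists_sqrt_bound[of 2 M] M by auto
  have "3 * M * M \<le> a ^ 2 * (2 * b ^ 2)" using a b M by (intro mult_mono) auto
  then have "3 * M ^ 2 \<le> 2 * (a * b) ^ 2" by (simp add: power2_eq_square algebra_simps)
  moreover have "M ^ 2 > 0" using M by simp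
  ultimately have "M ^ 2 < (a * b) ^ 2" by linarith
  then have "M < a * b" by (rule power2_less_imp_less) (use a b in auto)
  then obtain x y where xy: "(x, y) \<noteq> (0, 0)" "\<bar>x\<bar> < a" "\<bar>y\<bar> < b" "M dvd x - t * y"
    using thue[of M a b t] M a b by metis
  have "\<bar>x\<bar> ^ 2 \<le> (a - 1) ^ 2" "\<bar>y\<bar> ^ 2 \<le> (b - 1) ^ 2" using xy by (intro power_mono; simp)+
  then have bd: "x ^ 2 < 3 * M" "6 * y ^ 2 < 3 * M" using a b by auto
  have "x ^ 2 - 6 * y ^ 2 = (x - t * y) * (x + t * y) + (t ^ 2 - 6) * y ^ 2"
    by (simp add: power2_eq_square algebra_simps)
  then have "M dvd x ^ 2 - 6 * y ^ 2" using xy t by simp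
  then obtain k where k: "x ^ 2 - 6 * y ^ 2 = M * k" by (elim dvdE)
  have "M * k < M * 3" "M * (- 3) < M * k" using bd k by (smt (verit) zero_le_power2)+
  then have "k < 3" "- 3 < k" using M by (simp_all only: mult_less_cancel_left_pos)
  moreover have "k \<noteq> 0" using square_eq_6_square[of x y] xy k by auto
  ultimately consider "k = - 1" | "k = 2" | "k = 1" | "k = - 2" by linarith
  then show ?thesis
  proof cases
    case 1
    then show ?thesis using k xy by (intro that[of y x]) auto
  next
    case 2
    then have "x ^ 2 = 2 * (3 * y ^ 2 + M)" using k by simp
    then have "even (x ^ 2)" by simp
    then obtain u where u: "x = 2 * u" by (auto elim!: evenE)
    \<comment> \<open>(x + y sqrt 6) / (2 + sqrt 6) = (3y - x) + (x/2 - y) sqrt 6.\<close>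
    have "6 * (u - y) ^ 2 - (3 * y - x) ^ 2 = M"
      using k 2 u by (simp add: power2_eq_square algebra_simps)
    moreover have "M dvd (3 * y - x) - t * (u - y)"
    proof -
      have "coprime M 2" using M by simp presburger
      moreover have "2 * ((3 * y - x) - t * (u - y)) = - (t + 2) * (x - t * y) - (t ^ 2 - 6) * y"
        unfolding u by (simp add: power2_eq_square algebra_simps)
      then have "M dvd 2 * ((3 * y - x) - t * (u - y))" using xy t by simp
      ultimately show ?thesis using coprime_dvd_mult_right_iff by blast
    qed
    ultimately show ?thesis by (rule that)
  next
    case 3
    then have "x ^ 2 - 6 * y ^ 2 = M" using k by simp
    then have "(x ^ 2 mod 8 - 6 * (y ^ 2 mod 8)) mod 8 = M mod 8"
      by (metis mod_diff_eq mod_mult_right_eq mod_mod_trivial)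
    then have False using M(2) square_mod_8[of x] square_mod_8[of y] by auto
    then show ?thesis ..
  next
    case 4
    then have "x ^ 2 = 2 * (3 * y ^ 2 - M)" using k by simp
    then have "even (x ^ 2)" by simp
    then obtain u where u: "x = 2 * u" by (auto elim!: evenE)
    have "2 * u ^ 2 - 3 * y ^ 2 = - M" using k 4 u by (simp add: power2_eq_square)
    then have "(2 * (u ^ 2 mod 8) - 3 * (y ^ 2 mod 8)) mod 8 = (- M) mod 8"
      by (metis mod_diff_eq mod_mult_right_eq)
    moreover have "(- M) mod 8 = 1" using M(2) by presburger
    ultimately have False using square_mod_8[of u] square_mod_8[of y] by auto
    then show ?thesis ..
  qed
qed

text \<open>Multiplication by the unit \<open>5 - 2\<surd>6\<close> decreases \<open>y\<close> as long as \<open>2 y < x\<close>.\<close>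
lemma norm_form_reduced:
  fixes M t :: int
  assumes M: "M > 0" "M mod 8 = 7" and t: "M dvd t ^ 2 - 6"
  obtains x y where "6 * y ^ 2 - x ^ 2 = M" "M dvd x - t * y" "\<bar>x\<bar> < 2 * y"
proof -
  define P where "P y \<longleftrightarrow> (\<exists>x. 6 * int y ^ 2 - x ^ 2 = M \<and> M dvd x - t * int y)" for y :: nat
  obtain x y where xy: "6 * y ^ 2 - x ^ 2 = M" "M dvd x - t * y"
    using norm_form_represents[OF M t] by metis
  have "M dvd - x - t * (- y)" using xy(2) dvd_minus_iff[of M "x - t * y"] by (simp add: algebra_simps)
  then have "P (nat \<bar>y\<bar>)"
    unfolding P_def using xy by (cases "y \<ge> 0") (auto intro: exI[of _ x] exI[of _ "- x"])
  then have "P (LEAST y. P y)" by (rule LeastI)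
  define m where "m = (LEAST y. P y)"
  obtain x where x: "6 * int m ^ 2 - x ^ 2 = M" "M dvd x - t * int m"
    using \<open>P (LEAST y. P y)\<close> unfolding m_def[symmetric] unfolding P_def by blast
  have "m > 0" using x(1) M zero_le_power2[of x] by (cases "m = 0") auto
  have "\<bar>x\<bar> < 2 * int m"
  proof (rule ccontr)
    assume neg: "\<not> \<bar>x\<bar> < 2 * int m"
    have "odd x" using norm_form_parity[OF x(1) M(2)] by simp
    then have gt: "2 * int m < \<bar>x\<bar>" using neg by presburger
    have lt: "2 * \<bar>x\<bar> < 5 * int m"
    proof (rule power2_less_imp_less)
      have "(2 * \<bar>x\<bar>) ^ 2 = 24 * int m ^ 2 - 4 * M" using x(1) by (simp add: power_mult_distrib)
      also have "\<dots> < (5 * int m) ^ 2" using M zero_le_power2[of "int m"]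
        unfolding power_mult_distrib by (simp, linarith)
      finally show "(2 * \<bar>x\<bar>) ^ 2 < (5 * int m) ^ 2" .
    qed simp
    \<comment> \<open>The sign chooses between 5 - 2 sqrt 6 and its conjugate. The bounds
      \<open>gt\<close> and \<open>lt\<close> then place the new second coordinate in the range from
      0 to below m, against minimality.\<close>
    define s where "s = (if x \<ge> 0 then 1 else - 1 :: int)"
    have s: "s * x = \<bar>x\<bar>" "s = 1 \<or> s = - 1" by (auto simp: s_def)
    define y' where "y' = 5 * int m - 2 * (s * x)"
    define x' where "x' = 5 * x - 12 * (s * int m)"
    have y': "0 \<le> y'" "y' < int m" using lt gt unfolding y'_def s(1) by linarith+
    have "6 * y' ^ 2 - x' ^ 2 = M"
      unfolding x(1)[symmetric] y'_def x'_def using s(2)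
      by (auto simp: power2_eq_square algebra_simps)
    moreover have "x' - t * y' = (5 + 2 * s * t) * (x - t * int m) + 2 * s * int m * (t ^ 2 - 6)"
      unfolding y'_def x'_def by (simp add: power2_eq_square algebra_simps)
    then have "M dvd x' - t * y'" using x(2) t by simp
    ultimately have "P (nat y')" using y' unfolding P_def by auto
    moreover have "nat y' < m" using y' by simp
    ultimately show False unfolding m_def using not_less_Least by blast
  qed
  then show ?thesis using x by (intro that[of "int m" x]) auto
qed


text \<open>Substituting x = t y + M s and cancelling M writes 1 as a combination of y and M s = x -
  t y, both divisible by any common divisor of x and y.\<close>

lemma coprime_of_norm_form:
  fixes M t :: int
  assumes M: "M > 0" and xy: "6 * y ^ 2 - x ^ 2 = M" "M dvd x - t * y" and t: "M dvd t ^ 2 - 6"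
  shows "coprime x y"
proof (rule coprimeI)
  fix g assume g: "g dvd x" "g dvd y"
  obtain s where s: "x - t * y = M * s" using xy by (elim dvdE)
  obtain c where c: "t ^ 2 - 6 = M * c" using t by (elim dvdE)
  have "M * 1 = 6 * y ^ 2 - (t * y + M * s) ^ 2" using xy(1) s by (simp add: algebra_simps)
  also have "\<dots> = - (t ^ 2 - 6) * y ^ 2 - 2 * (t * y) * (M * s) - (M * s) * (M * s)"
    by (simp add: power2_eq_square algebra_simps)
  also have "\<dots> = M * (- c * y ^ 2 - 2 * (t * y) * s - s * (M * s))"
    unfolding c by (simp add: algebra_simps)
  finally have one: "1 = - c * y ^ 2 - 2 * (t * y) * s - s * (M * s)"
    using M by simp
  have "g dvd M * s" unfolding s[symmetric] using g by simp
  then have "g dvd - c * y ^ 2 - 2 * (t * y) * s - s * (M * s)"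
    using g by (intro dvd_diff) (auto simp: power2_eq_square)
  then show "is_unit g" using one by simp
qed

text \<open>Two solutions belonging to the same root differ by a unit \<open>u + v \<surd>6\<close>; being reduced forces
  \<open>\<bar>v\<bar> < 2\<close>, hence \<open>v = 0\<close>.\<close>
lemma primitive_sols_unique:
  assumes M: "M > 0" and p: "(x, y) \<in> primitive_sols M" "(x', y') \<in> primitive_sols M"
    and t: "M dvd t ^ 2 - 6" "M dvd x - t * y" "M dvd x' - t * y'"
  shows "x = x' \<and> y = y'"
proof -
  have xy: "\<bar>x\<bar> < 2 * y" "6 * y ^ 2 - x ^ 2 = M" "coprime x y"
    and xy': "\<bar>x'\<bar> < 2 * y'" "6 * y' ^ 2 - x' ^ 2 = M" "coprime x' y'"
    using p by (auto simp: primitive_sols_def)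
  have pos: "y > 0" "y' > 0" using xy xy' by auto
  have "x * y' - x' * y = (x - t * y) * y' - (x' - t * y') * y" by (simp add: algebra_simps)
  then have "M dvd x * y' - x' * y" using t by simp
  then obtain v where v: "x * y' - x' * y = M * v" by (elim dvdE)
  have "x * x' - 6 * (y * y') = (x - t * y) * x' + (x' - t * y') * (t * y) + (t ^ 2 - 6) * (y * y')"
    by (simp add: power2_eq_square algebra_simps)
  then have "M dvd x * x' - 6 * (y * y')" using t by simp
  then obtain u where u: "x * x' - 6 * (y * y') = M * u" by (elim dvdE)
  \<comment> \<open>(x + y sqrt 6)(x' - y' sqrt 6) = M (u - v sqrt 6), so multiplicativity of the
    norm makes u - v sqrt 6 a unit of norm 1.\<close>
  have "(x * x' - 6 * (y * y')) ^ 2 - 6 * (x * y' - x' * y) ^ 2 = (6 * y ^ 2 - x ^ 2) * (6 * y' ^ 2 - x' ^ 2)"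
    by (simp add: power2_eq_square algebra_simps)
  then have "M ^ 2 * (u ^ 2 - 6 * v ^ 2) = M ^ 2 * 1"
    unfolding u v xy(2) xy'(2) by (simp add: power2_eq_square algebra_simps)
  then have unit: "u ^ 2 - 6 * v ^ 2 = 1" using M by simp
  \<comment> \<open>Being reduced gives 2y^2 < M and 2y'^2 < M, hence 2 y y' < M; this is what
    bounds v.\<close>
  have "\<bar>x\<bar> ^ 2 < (2 * y) ^ 2" "\<bar>x'\<bar> ^ 2 < (2 * y') ^ 2"
    using xy xy' by (intro power_strict_mono; simp)+
  then have "2 * y ^ 2 < M" "2 * y' ^ 2 < M" using xy(2) xy'(2) by (auto simp: power_mult_distrib)
  then have "2 * y ^ 2 * (2 * y' ^ 2) < M * M" using pos M by (intro mult_strict_mono) auto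
  then have "(2 * (y * y')) ^ 2 < M ^ 2" by (simp add: power2_eq_square algebra_simps)
  then have *: "2 * (y * y') < M" by (rule power2_less_imp_less) (use M in auto)
  have "\<bar>x * y' - x' * y\<bar> \<le> \<bar>x\<bar> * y' + \<bar>x'\<bar> * y"
    using pos by (metis abs_mult abs_of_pos abs_triangle_ineq4)
  also have "\<dots> < 2 * y * y' + 2 * y' * y"
    using xy xy' pos by (intro add_strict_mono mult_strict_right_mono) auto
  also have "\<dots> < M * 2" using * by (simp add: algebra_simps)
  finally have "M * \<bar>v\<bar> < M * 2" unfolding v using M by (simp add: abs_mult)
  then have "\<bar>v\<bar> < 2" using M by simp
  then consider "v = 0" | "v = 1 \<or> v = - 1" by linarith
  then show ?thesis
  proof cases
    case 1
    then have eq: "x * y' = x' * y" using v by simp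
    then have "y' dvd y" using xy'(3) by (metis coprime_commute coprime_dvd_mult_right_iff dvd_triv_right)
    moreover have "y dvd y'" using eq xy(3) by (metis coprime_commute coprime_dvd_mult_right_iff dvd_triv_right)
    ultimately have "y = y'" using pos by (metis zdvd_antisym_nonneg less_imp_le)
    then show ?thesis using eq pos by simp
  next
    case 2
    then have "u ^ 2 = 7" using unit by auto
    then show ?thesis using square_mod_8[of u] by simp
  qed
qed

text \<open>A root t corresponds to the reduced solution with x = t y modulo M. Conversely,
  primitivity makes y invertible modulo M, and t = x / y is a root.\<close>

lemma card_primitive_sols:
  assumes M: "M > 0" "M mod 8 = 7"
  shows "card (primitive_sols M) = card (sqrt6_roots M)"
proof -
  define R where "R t p \<longleftrightarrow> p \<in> primitive_sols M \<and> M dvd fst p - t * snd p" for t p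
  define f where "f t = (SOME p. R t p)" for t
  have R: "R t (f t)" if t: "t \<in> sqrt6_roots M" for t
  proof -
    have d: "M dvd t ^ 2 - 6" using t by (simp add: sqrt6_roots_def)
    obtain x y where "6 * y ^ 2 - x ^ 2 = M" "M dvd x - t * y" "\<bar>x\<bar> < 2 * y"
      using norm_form_reduced[OF M d] by metis
    then have "R t (x, y)"
      using coprime_of_norm_form[OF M(1) _ _ d] by (auto simp: R_def primitive_sols_def)
    then show ?thesis unfolding f_def by (rule someI)
  qed
  have cop: "coprime M y" if "(x, y) \<in> primitive_sols M" for x y
  proof -
    have "6 * y ^ 2 - x ^ 2 = M" "coprime x y" using that by (auto simp: primitive_sols_def)
    show ?thesis
    proof (rule coprimeI)
      fix g assume g: "g dvd M" "g dvd y"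
      have "x ^ 2 = 6 * y ^ 2 - M" using \<open>6 * y ^ 2 - x ^ 2 = M\<close> by simp
      then have "g dvd x ^ 2" using g by (simp add: power2_eq_square)
      moreover have "coprime (x ^ 2) y" using \<open>coprime x y\<close> by simp
      ultimately show "is_unit g" using g coprime_common_divisor by blast
    qed
  qed
  have "bij_betw f (sqrt6_roots M) (primitive_sols M)"
    unfolding bij_betw_def
  proof (intro conjI inj_onI subset_antisym subsetI)
    fix t t' assume t: "t \<in> sqrt6_roots M" "t' \<in> sqrt6_roots M" and eq: "f t = f t'"
    obtain x y where xy: "f t = (x, y)" by (cases "f t")
    have *: "(x, y) \<in> primitive_sols M" "M dvd x - t * y" "M dvd x - t' * y"
      using R[OF t(1)] R[OF t(2)] unfolding eq[symmetric] by (auto simp: R_def xy)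
    have "M dvd (x - t' * y) - (x - t * y)" using *(3,2) by (rule dvd_diff)
    then have "M dvd (t - t') * y" by (simp add: algebra_simps)
    then have "M dvd t - t'" using cop[OF *(1)] coprime_dvd_mult_left_iff by blast
    then have "t mod M = t' mod M" by (simp add: mod_eq_dvd_iff)
    then show "t = t'" using t by (simp add: sqrt6_roots_def)
  next
    fix p assume "p \<in> f ` sqrt6_roots M"
    then show "p \<in> primitive_sols M" using R by (auto simp: R_def)
  next
    fix p assume p: "p \<in> primitive_sols M"
    obtain x y where xy: "p = (x, y)" by (cases p)
    have "coprime y M" using cop[of x y] p xy by (simp add: coprime_commute)
    then obtain w where w: "[y * w = 1] (mod M)" using cong_solve_coprime_int by blast
    then have w: "M dvd y * w - 1" by (simp add: cong_iff_dvd_diff)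
    define t where "t = (x * w) mod M"
    have "M dvd t - x * w" by (simp add: t_def mod_eq_dvd_iff[symmetric])
    then have "M dvd (t - x * w) * y + x * (y * w - 1)" using w by simp
    then have ty: "M dvd t * y - x" by (simp add: algebra_simps)
    have "6 * y ^ 2 - x ^ 2 = M" using p by (simp add: xy primitive_sols_def)
    then have "(t ^ 2 - 6) * y ^ 2 = (t * y - x) * (t * y + x) - M"
      by (simp add: power2_eq_square algebra_simps)
    then have "M dvd (t ^ 2 - 6) * y ^ 2" using ty by simp
    then have "M dvd t ^ 2 - 6" using cop p xy coprime_dvd_mult_left_iff[of M "y ^ 2"] by simp
    then have t: "t \<in> sqrt6_roots M" using M by (simp add: sqrt6_roots_def t_def)
    obtain x' y' where xy': "f t = (x', y')" by (cases "f t")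
    have "x = x' \<and> y = y'"
      by (rule primitive_sols_unique[OF M(1), of _ _ _ _ t])
        (use p R[OF t] t ty in \<open>auto simp: xy xy' R_def sqrt6_roots_def dvd_diff_commute\<close>)
    then show "p \<in> f ` sqrt6_roots M" using t xy xy' by (metis image_eqI)
  qed
  then show ?thesis by (simp add: bij_betw_same_card)
qed

lemma finite_norm_sols: "finite (norm_sols N)"
proof (rule finite_subset)
  show "norm_sols N \<subseteq> {0..N} \<times> {0..N}"
  proof safe
    fix x y assume "(x, y) \<in> norm_sols N"
    then have *: "0 < x" "x < 2 * y" "6 * y ^ 2 - x ^ 2 = N" by (auto simp: norm_sols_def)
    have "x ^ 2 < (2 * y) ^ 2" using * by (intro power_strict_mono) auto
    then have "2 * y ^ 2 \<le> N" using *(3) by (simp add: power_mult_distrib)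
    moreover have "1 * y \<le> y ^ 2" unfolding power2_eq_square using * by (intro mult_right_mono) auto
    ultimately show "x \<in> {0..N}" "y \<in> {0..N}" using * by auto
  qed
qed auto

definition primitive_norm_sols :: "int \<Rightarrow> (int \<times> int) set" where
  "primitive_norm_sols M = {(x, y) \<in> norm_sols M. coprime x y}"

text \<open>In a primitive solution x is odd, hence nonzero, so x -> -x exchanges two equally large
  halves.\<close>

lemma card_sqrt6_roots:
  assumes M: "M > 0" "M mod 8 = 7"
  shows "card (sqrt6_roots M) = 2 * card (primitive_norm_sols M)"
proof -
  let ?A = "primitive_norm_sols M"
  let ?B = "(\<lambda>(x, y). (- x, y)) ` ?A"
  have "primitive_sols M = ?A \<union> ?B"
  proof (intro subset_antisym subsetI)
    fix p assume p: "p \<in> primitive_sols M"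
    obtain x y where xy: "p = (x, y)" by (cases p)
    have "x \<noteq> 0" using p M norm_form_parity[of y x M] by (auto simp: xy primitive_sols_def)
    then have "(x, y) \<in> ?A \<or> (- x, y) \<in> ?A"
      using p by (auto simp: xy primitive_sols_def primitive_norm_sols_def norm_sols_def)
    then show "p \<in> ?A \<union> ?B" unfolding xy by force
  qed (auto simp: primitive_sols_def primitive_norm_sols_def norm_sols_def)
  moreover have "?A \<inter> ?B = {}"
  proof -
    have "fst p > 0" if "p \<in> ?A" for p using that by (auto simp: primitive_norm_sols_def norm_sols_def)
    moreover have "fst p < 0" if "p \<in> ?B" for p using that by (auto simp: primitive_norm_sols_def norm_sols_def)
    ultimately show ?thesis by fastforce
  qed
  moreover have "finite ?A" using finite_norm_sols by (rule finite_subset[rotated]) (auto simp: primitive_norm_sols_def)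
  moreover have "card ?B = card ?A" by (rule card_image) (auto simp: inj_on_def)
  ultimately show ?thesis
    by (simp only: card_primitive_sols[OF M, symmetric] card_Un_disjoint finite_imageI mult_2)
qed

section \<open>Counting the square roots of 6 modulo M\<close>

lemma finite_sqrt6_roots [simp]: "finite (sqrt6_roots M)"
  by (rule finite_subset[of _ "{0..<M}"]) (auto simp: sqrt6_roots_def)

lemma mod_in_sqrt6_roots:
  assumes "M > 0" "M dvd t ^ 2 - 6"
  shows "t mod M \<in> sqrt6_roots M"
proof -
  have "(t mod M) ^ 2 mod M = 6 mod M"
    using assms(2) by (simp add: power_mod mod_eq_dvd_iff)
  then show ?thesis using assms(1) by (simp add: sqrt6_roots_def mod_eq_dvd_iff)
qed

text \<open>Chinese remainder theorem: reduction modulo A and modulo B identifies the roots with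
  pairs of roots.\<close>

lemma card_sqrt6_roots_mult:
  assumes "A > 0" "B > 0" "coprime A B"
  shows "card (sqrt6_roots (A * B)) = card (sqrt6_roots A) * card (sqrt6_roots B)"
proof -
  let ?f = "\<lambda>t. (t mod A, t mod B)"
  have "bij_betw ?f (sqrt6_roots (A * B)) (sqrt6_roots A \<times> sqrt6_roots B)"
    unfolding bij_betw_def
  proof (intro conjI inj_onI subset_antisym subsetI)
    fix t t' assume t: "t \<in> sqrt6_roots (A * B)" "t' \<in> sqrt6_roots (A * B)" and eq: "?f t = ?f t'"
    have "A dvd t - t'" "B dvd t - t'" using eq by (auto simp: mod_eq_dvd_iff)
    then have "A * B dvd t - t'" using assms(3) by (rule divides_mult)
    then have "t mod (A * B) = t' mod (A * B)" by (simp add: mod_eq_dvd_iff)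
    then show "t = t'" using t by (simp add: sqrt6_roots_def)
  next
    fix p assume "p \<in> ?f ` sqrt6_roots (A * B)"
    then obtain t where t: "t \<in> sqrt6_roots (A * B)" "p = ?f t" by auto
    have "A * B dvd t ^ 2 - 6" using t by (simp add: sqrt6_roots_def)
    then have "A dvd t ^ 2 - 6" "B dvd t ^ 2 - 6" using dvd_mult_left dvd_mult_right by blast+
    then show "p \<in> sqrt6_roots A \<times> sqrt6_roots B" using assms t by (auto intro: mod_in_sqrt6_roots)
  next
    fix p assume p: "p \<in> sqrt6_roots A \<times> sqrt6_roots B"
    obtain u v where uv: "p = (u, v)" by (cases p)
    obtain t where t: "[t = u] (mod A)" "[t = v] (mod B)"
      using binary_chinese_remainder_int[OF assms(3)] by blast
    have "[t ^ 2 - 6 = u ^ 2 - 6] (mod A)" "[t ^ 2 - 6 = v ^ 2 - 6] (mod B)"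
      using t by (auto intro: cong_diff cong_pow)
    then have "A dvd t ^ 2 - 6" "B dvd t ^ 2 - 6"
      using p uv by (auto simp: sqrt6_roots_def cong_dvd_iff)
    then have "A * B dvd t ^ 2 - 6" using assms(3) by (rule divides_mult)
    then have "t mod (A * B) \<in> sqrt6_roots (A * B)" using assms by (intro mod_in_sqrt6_roots) auto
    moreover have "?f (t mod (A * B)) = p"
      using t p by (auto simp: uv mod_mod_cancel cong_def sqrt6_roots_def)
    ultimately show "p \<in> ?f ` sqrt6_roots (A * B)" by (intro image_eqI[of _ _ "t mod (A * B)"]) simp_all
  qed
  then show ?thesis by (simp add: bij_betw_same_card card_cartesian_product)
qed

text \<open>The involution t -> A - t has no fixed point as A is odd. It stays within the range 0
  \<le> t < A because t = 0 would require A to divide 6, impossible for odd A > 3.\<close>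

lemma even_card_sqrt6_roots:
  assumes "odd A" "A > 3"
  shows "even (card (sqrt6_roots A))"
proof -
  let ?L = "{t \<in> sqrt6_roots A. 2 * t < A}"
  let ?R = "(\<lambda>t. A - t) ` ?L"
  have neg: "A - t \<in> sqrt6_roots A" if t: "t \<in> sqrt6_roots A" for t
  proof -
    have "t \<noteq> 0"
    proof
      assume "t = 0"
      then have "A dvd 6" using t by (simp add: sqrt6_roots_def)
      moreover from this have "A \<le> 6" by (rule zdvd_imp_le) simp
      moreover have "A \<noteq> 4" "A \<noteq> 6" using assms by auto
      ultimately have "A = 5" using assms by auto
      then show False using \<open>A dvd 6\<close> by simp
    qed
    moreover have "(A - t) ^ 2 - 6 = A * (A - 2 * t) + (t ^ 2 - 6)"
      by (simp add: power2_eq_square algebra_simps)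
    then have "A dvd (A - t) ^ 2 - 6" using t unfolding sqrt6_roots_def by (metis (no_types, lifting) dvd_add dvd_triv_left mem_Collect_eq)
    ultimately show ?thesis using t by (simp add: sqrt6_roots_def)
  qed
  have "sqrt6_roots A = ?L \<union> ?R"
  proof (intro subset_antisym subsetI)
    fix t assume t: "t \<in> sqrt6_roots A"
    have "2 * t \<noteq> A" using assms by auto
    then consider "t \<in> ?L" | "A - t \<in> ?L" using t neg[OF t] by fastforce
    then show "t \<in> ?L \<union> ?R"
    proof cases
      case 2
      then have "A - (A - t) \<in> ?R" by (rule imageI)
      then show ?thesis by simp
    qed simp
  qed (use neg in auto)
  moreover have "?L \<inter> ?R = {}" by auto
  moreover have "card ?R = card ?L" by (rule card_image) (auto simp: inj_on_def)
  ultimately have "card (sqrt6_roots A) = 2 * card ?L"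
    by (metis (no_types, lifting) card_Un_disjoint finite_Un finite_sqrt6_roots mult_2)
  then show ?thesis by simp
qed

text \<open>Hensel lifting by the Newton step s - p^(e+1) w c with w inverse to 2s modulo p. The
  inverse exists because (2s)^2 - 4(s^2 - 6) = 24 has no prime factor above 3.\<close>

lemma sqrt6_lift:
  assumes p: "prime p" "p > 3" and t: "p dvd t ^ 2 - (6 :: int)"
  shows "\<exists>s. p ^ Suc e dvd s ^ 2 - 6"
proof (induction e)
  case 0
  then show ?case using t by auto
next
  case (Suc e)
  then obtain s c where s: "s ^ 2 - 6 = p ^ Suc e * c" unfolding dvd_def by blast
  have "\<not> p dvd 2 * s"
  proof
    assume "p dvd 2 * s"
    then have "p dvd (2 * s) ^ 2" unfolding power2_eq_square by (rule dvd_mult)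
    moreover have "24 = (2 * s) ^ 2 - 4 * (p * (p ^ e * c))" using s by (simp add: power_mult_distrib)
    ultimately have "p dvd 24" by (metis dvd_diff dvd_mult dvd_triv_left)
    then have "p dvd 2 * (2 * (2 * 3))" by simp
    then have "p dvd 2 \<or> p dvd 3" using p(1) prime_dvd_mult_iff by blast
    then show False using p(2) zdvd_imp_le[of p 2] zdvd_imp_le[of p 3] by auto
  qed
  then have "coprime (2 * s) p" using p(1) prime_imp_coprime coprime_commute by blast
  then obtain w where "[2 * s * w = 1] (mod p)" using cong_solve_coprime_int by blast
  then obtain d where d: "2 * s * w - 1 = p * d" by (auto simp: cong_iff_dvd_diff dvd_def)
  have "(s - p ^ Suc e * (w * c)) ^ 2 - 6 = (s ^ 2 - 6) - p ^ Suc e * ((2 * s * w) * c) + p ^ Suc e * p ^ Suc e * (w * c) ^ 2"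
    by (simp add: power2_eq_square algebra_simps)
  also have "\<dots> = p ^ Suc e * (c - (p * d + 1) * c) + p ^ Suc e * p ^ Suc e * (w * c) ^ 2"
    unfolding s d[symmetric] by (simp add: algebra_simps)
  also have "\<dots> = p ^ Suc (Suc e) * (- d * c + p ^ e * (w * c) ^ 2)"
    by (simp add: algebra_simps)
  finally show ?case by (metis dvd_triv_left)
qed

text \<open>For a fixed root r and any root u, the prime p divides at most one of u - r and u + r,
  since it does not divide 2r. The full power of p therefore divides one of them.\<close>

lemma card_sqrt6_roots_prime_power:
  assumes p: "prime p" "p > 3" and t: "p dvd t ^ 2 - (6 :: int)"
  shows "card (sqrt6_roots (p ^ Suc e)) = 2"
proof -
  define A where "A = p ^ Suc e"
  have "p > 0" using p by simp
  have odd: "odd p" using p prime_odd_int by force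
  then have oddA: "odd A" by (simp add: A_def)
  have "A > 0" using \<open>p > 0\<close> by (simp add: A_def)
  obtain s where "A dvd s ^ 2 - 6" using sqrt6_lift[OF p t] unfolding A_def by blast
  then have s: "s mod A \<in> sqrt6_roots A" using \<open>A > 0\<close> by (intro mod_in_sqrt6_roots)
  define r where "r = s mod A"
  have r: "0 \<le> r" "r < A" "A dvd r ^ 2 - 6" using s by (auto simp: sqrt6_roots_def r_def)
  have notp: "\<not> p dvd r"
  proof
    assume "p dvd r"
    then have "p dvd r ^ 2" unfolding power2_eq_square by (rule dvd_mult)
    moreover have "p dvd r ^ 2 - 6" using r(3) dvd_trans[of p A] by (simp add: A_def)
    ultimately have "p dvd r ^ 2 - (r ^ 2 - 6)" by (rule dvd_diff)
    then have "p dvd 2 * 3" by simp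
    then have "p dvd 2 \<or> p dvd 3" using p(1) prime_dvd_mult_iff by blast
    then show False using p(2) zdvd_imp_le[of p 2] zdvd_imp_le[of p 3] by auto
  qed
  then have "r \<noteq> 0" by auto
  have "sqrt6_roots A = {r, A - r}"
  proof (intro subset_antisym subsetI)
    fix u assume u: "u \<in> sqrt6_roots A"
    then have "A dvd (u ^ 2 - 6) - (r ^ 2 - 6)" using r(3) unfolding sqrt6_roots_def by (metis (no_types, lifting) dvd_diff mem_Collect_eq)
    then have dv: "A dvd (u - r) * (u + r)" by (simp add: power2_eq_square algebra_simps)
    have "\<not> (p dvd u - r \<and> p dvd u + r)"
    proof safe
      assume "p dvd u - r" "p dvd u + r"
      then have "p dvd (u + r) - (u - r)" by (metis dvd_diff)
      then have "p dvd 2 * r" by simp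
      then have "p dvd 2" using notp p(1) prime_dvd_mult_iff by blast
      then show False using p(2) zdvd_imp_le[of p 2] by auto
    qed
    then have "coprime A (u - r) \<or> coprime A (u + r)"
      unfolding A_def using p(1) prime_imp_coprime by (metis coprime_power_left_iff)
    then have "A dvd u + r \<or> A dvd u - r"
      using dv coprime_dvd_mult_right_iff coprime_dvd_mult_left_iff by blast
    then show "u \<in> {r, A - r}"
    proof
      assume "A dvd u + r"
      then obtain k where k: "u + r = A * k" by (elim dvdE)
      have "0 < A * k" "A * k < A * 2"
        using u r \<open>r \<noteq> 0\<close> unfolding k[symmetric] by (auto simp: sqrt6_roots_def)
      then have "k = 1" using \<open>A > 0\<close> by (simp add: zero_less_mult_iff)
      then show ?thesis using k by simp
    next
      assume "A dvd u - r"
      then have "u mod A = r mod A" by (simp add: mod_eq_dvd_iff)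
      then show ?thesis using u r by (simp add: sqrt6_roots_def)
    qed
  next
    fix u assume "u \<in> {r, A - r}"
    moreover have "(A - r) ^ 2 - 6 = A * (A - 2 * r) + (r ^ 2 - 6)"
      by (simp add: power2_eq_square algebra_simps)
    then have "A dvd (A - r) ^ 2 - 6" using r(3) by (metis dvd_add dvd_triv_left)
    ultimately show "u \<in> sqrt6_roots A" using r \<open>r \<noteq> 0\<close> by (auto simp: sqrt6_roots_def)
  qed
  moreover have "r \<noteq> A - r" using oddA by auto
  ultimately show ?thesis by (simp add: A_def)
qed

lemma sqrt6_roots_3: "sqrt6_roots 3 = {0}"
proof (intro subset_antisym subsetI)
  fix t assume t: "t \<in> sqrt6_roots 3"
  then have "t = 0 \<or> t = 1 \<or> t = 2" by (auto simp: sqrt6_roots_def)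
  then show "t \<in> {0}" using t by (auto simp: sqrt6_roots_def)
qed (auto simp: sqrt6_roots_def)

text \<open>9 dividing t^2 - 6 would force 3 to divide t and hence 9 to divide 6. This limits the
  exponent of 3 to at most 1.\<close>

lemma sqrt6_roots_9: "9 dvd M \<Longrightarrow> sqrt6_roots M = {}"
proof (rule ccontr)
  assume "9 dvd M" "sqrt6_roots M \<noteq> {}"
  then obtain t where "M dvd t ^ 2 - 6" by (auto simp: sqrt6_roots_def)
  with \<open>9 dvd M\<close> have t: "9 dvd t ^ 2 - 6" by (rule dvd_trans)
  then have "3 dvd t ^ 2" by presburger
  then have "3 dvd t" using prime_dvd_power_int[of 3 t 2] by simp
  then obtain s where "t = 3 * s" by (elim dvdE)
  then have "9 dvd 9 * s ^ 2 - 6" using t by (simp add: power_mult_distrib)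
  then show False by presburger
qed

section \<open>Quadratic residues\<close>

text \<open>Gauss's lemma: the sign is given by the parity of the number of even residues above p/2,
  which is 2m + 2 for p = 8m + 7 and 2m + 1 for p = 8m + 5.\<close>

lemma Legendre_2:
  assumes p: "prime p" "p > 2"
  shows "p mod 8 = 7 \<Longrightarrow> Legendre 2 (int p) = 1"
    and "p mod 8 = 5 \<Longrightarrow> Legendre 2 (int p) = - 1"
proof -
  have ncong: "[2 \<noteq> 0] (mod int p)"
    using p zdvd_imp_le[of "int p" 2] by (auto simp: cong_0_iff)
  interpret GAUSS p 2
    using p ncong by unfold_locales auto
  have E: "E = {x. even x \<and> (int p - 1) div 2 < x \<and> x < int p}"
  proof -
    \<comment> \<open>The doubled residues are already below p, so reducing them modulo p changes
      nothing.\<close>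
    have C: "C = (\<lambda>x. x * 2) ` A"
      unfolding C_def B_def image_image by (intro image_cong refl) (auto simp: A_def)
    have "odd p" by (rule odd_p)
    show ?thesis
    proof (intro subset_antisym subsetI)
      fix x assume "x \<in> E"
      then show "x \<in> {x. even x \<and> (int p - 1) div 2 < x \<and> x < int p}"
        unfolding E_def C A_def by auto
    next
      fix x assume x: "x \<in> {x. even x \<and> (int p - 1) div 2 < x \<and> x < int p}"
      then obtain y where "x = y * 2" by (auto elim!: evenE)
      then show "x \<in> E" using x \<open>odd p\<close> unfolding E_def C A_def by (auto intro!: image_eqI[of _ _ y])
    qed
  qed
  show "Legendre 2 (int p) = 1" if "p mod 8 = 7"
  proof -
    obtain m where m: "p = 8 * m + 7" using \<open>p mod 8 = 7\<close> by (metis mult_div_mod_eq)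
    have "E = (\<lambda>k. 2 * int k) ` {2 * m + 2..4 * m + 3}"
    proof (intro subset_antisym subsetI)
      fix x assume "x \<in> E"
      then have x: "even x" "4 * int m + 3 < x" "x < 8 * int m + 7" unfolding E by (auto simp: m)
      then obtain y where y: "x = 2 * y" by (auto elim!: evenE)
      then have "x = 2 * int (nat y)" "nat y \<in> {2 * m + 2..4 * m + 3}" using x by auto
      then show "x \<in> (\<lambda>k. 2 * int k) ` {2 * m + 2..4 * m + 3}" by blast
    qed (auto simp: E, auto simp: m)
    then have "card E = 2 * m + 2" by (simp add: card_image inj_on_def)
    then show ?thesis using gauss_lemma by simp
  qed
  show "Legendre 2 (int p) = - 1" if "p mod 8 = 5"
  proof -
    obtain m where m: "p = 8 * m + 5" using \<open>p mod 8 = 5\<close> by (metis mult_div_mod_eq)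
    have "E = (\<lambda>k. 2 * int k) ` {2 * m + 2..4 * m + 2}"
    proof (intro subset_antisym subsetI)
      fix x assume "x \<in> E"
      then have x: "even x" "4 * int m + 2 < x" "x < 8 * int m + 5" unfolding E by (auto simp: m)
      then obtain y where y: "x = 2 * y" by (auto elim!: evenE)
      then have "x = 2 * int (nat y)" "nat y \<in> {2 * m + 2..4 * m + 2}" using x by auto
      then show "x \<in> (\<lambda>k. 2 * int k) ` {2 * m + 2..4 * m + 2}" by blast
    qed (auto simp: E, auto simp: m)
    then have "card E = 2 * m + 1" by (simp add: card_image inj_on_def)
    then show ?thesis using gauss_lemma by simp
  qed
qed

text \<open>In both classes p = 2 modulo 3 is a nonresidue of 3, so reciprocity leaves only the
  dependence on p modulo 4.\<close>

lemma Legendre_3: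
  assumes p: "prime p" and mod: "p mod 24 = 5 \<or> p mod 24 = 23"
  shows "Legendre 3 (int p) = (if p mod 24 = 5 then - 1 else 1)"
proof -
  have p3: "p \<noteq> 3" "p > 2" using mod by auto
  have L: "Legendre (int p) 3 = - 1"
  proof -
    have p2: "int p mod 3 = 2" using mod by presburger
    have "\<not> QuadRes 3 (int p)"
    proof
      assume "QuadRes 3 (int p)"
      then obtain y where "y ^ 2 mod 3 = int p mod 3" by (auto simp: QuadRes_def cong_def)
      moreover have "y mod 3 = 0 \<or> y mod 3 = 1 \<or> y mod 3 = 2" by presburger
      then have "y ^ 2 mod 3 = 0 \<or> y ^ 2 mod 3 = 1"
        by (auto simp: power2_eq_square mod_mult_eq[of y 3 y, symmetric])
      ultimately show False using p2 by simp
    qed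
    moreover have "\<not> [int p = 0] (mod 3)" using p2 by (simp add: cong_def)
    ultimately show ?thesis by (simp add: Legendre_def)
  qed
  have "Legendre 3 (int p) * Legendre (int p) 3 = (- 1) ^ ((3 - 1) div 2 * ((p - 1) div 2))"
    using Quadratic_Reciprocity[of 3 p] p p3 by simp
  moreover have "even ((p - 1) div 2) \<longleftrightarrow> p mod 24 = 5" using mod by presburger
  ultimately show ?thesis unfolding L by (auto simp: minus_one_power_iff)
qed

text \<open>2 and 3 are both nonresidues for p = 5 and both residues for p = 23 modulo 24; Euler's
  criterion multiplies the two symbols.\<close>

lemma exists_sqrt6_mod_prime:
  assumes p: "prime p" and mod: "p mod 24 = 5 \<or> p mod 24 = 23"
  shows "\<exists>t. int p dvd t ^ 2 - 6"
proof -
  have p2: "p > 2" using mod by auto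
  define k where "k = (p - 1) div 2"
  have "[Legendre a (int p) = a ^ k] (mod int p)" for a
    using euler_criterion[of p a] p p2 by (simp add: k_def)
  note eu = this
  have "Legendre 2 (int p) * Legendre 3 (int p) = 1"
    using mod
  proof
    assume m: "p mod 24 = 5"
    then have "p mod 8 = 5" by presburger
    then show ?thesis using Legendre_2(2)[OF p p2] Legendre_3[OF p mod] m by simp
  next
    assume m: "p mod 24 = 23"
    then have "p mod 8 = 7" by presburger
    then show ?thesis using Legendre_2(1)[OF p p2] Legendre_3[OF p mod] m by simp
  qed
  then have "[1 = 2 ^ k * 3 ^ k] (mod int p)" using cong_mult[OF eu[of 2] eu[of 3]] by simp
  then have "[1 = 6 ^ k] (mod int p)" by (simp add: power_mult_distrib[symmetric])
  then have "[Legendre 6 (int p) = 1] (mod int p)" using eu[of 6] cong_sym cong_trans by blast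
  then have "int p dvd Legendre 6 (int p) - 1" by (simp add: cong_iff_dvd_diff)
  moreover have "\<not> int p dvd - 1" "\<not> int p dvd - 2"
    using p2 zdvd_imp_le[of "int p" 1] zdvd_imp_le[of "int p" 2] by auto
  ultimately have "QuadRes (int p) 6" by (auto simp: Legendre_def split: if_splits)
  then show ?thesis by (auto simp: QuadRes_def cong_iff_dvd_diff)
qed

section \<open>Moduli with an odd number of primitive solutions\<close>

lemma mod_24_eqI:
  fixes p r :: nat
  assumes "p mod 3 = r mod 3" "p mod 8 = r mod 8"
  shows "p mod 24 = r mod 24"
proof -
  have "coprime (3 :: nat) 8" by (simp add: coprime_iff_gcd_eq_1 gcd_non_0_nat)
  then have "[p = r] (mod 3 * 8)" using assms by (intro coprime_cong_mult_nat) (auto simp: cong_def)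
  then show ?thesis by (simp add: cong_def)
qed

lemma square_mod_3: "(x :: int) ^ 2 mod 3 = 0 \<or> x ^ 2 mod 3 = 1"
proof -
  have "x mod 3 = 0 \<or> x mod 3 = 1 \<or> x mod 3 = 2" by presburger
  then show ?thesis by (auto simp: power2_eq_square mod_mult_eq[of x 3 x, symmetric])
qed

text \<open>For the moduli 8 and 3 this replaces p^e with odd e by p itself.\<close>

lemma power_mod_of_square_mod:
  fixes p :: int
  assumes "p ^ 2 mod m = 1 mod m"
  shows "p ^ (2 * k) mod m = 1 mod m" and "p ^ (2 * k + 1) mod m = p mod m"
proof -
  have "(p ^ 2) ^ k mod m = 1 ^ k mod m" using assms by (metis power_mod)
  then show *: "p ^ (2 * k) mod m = 1 mod m" by (simp add: power_mult)
  show "p ^ (2 * k + 1) mod m = p mod m"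
    using * by (metis mod_mult_left_eq mult_1 power_add power_one_right)
qed

lemma odd_square_mod_8: "odd (x :: int) \<Longrightarrow> x ^ 2 mod 8 = 1"
proof -
  assume "odd x"
  then have "odd (x ^ 2)" by simp
  have aux: "s mod 8 = 1" if "odd s" "s mod 8 = 0 \<or> s mod 8 = 1 \<or> s mod 8 = 4" for s :: int
    using that by presburger
  show ?thesis by (rule aux[OF \<open>odd (x ^ 2)\<close> square_mod_8])
qed

text \<open>Once \<open>M = 3\<^sup>a p\<^sup>e\<close> has a root, the existence of a solution of \<open>6 y\<^sup>2 - x\<^sup>2 = M\<close>
  excludes \<open>p \<equiv> 1 (mod 3)\<close>.\<close>
lemma prime_residue_of_root:
  fixes p :: nat
  assumes p: "prime p" "p > 3" and a: "a \<le> 1" and M: "3 ^ a * int p ^ e mod 8 = 7"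
    and t: "t \<in> sqrt6_roots (3 ^ a * int p ^ e)"
  shows "p mod 24 = 5 \<or> p mod 24 = 23"
proof -
  have odd: "odd p" using p by (simp add: prime_odd_nat)
  have "\<not> 3 dvd p" using p primes_dvd_imp_eq[of 3 p] by auto
  then have n3: "int p mod 3 = 1 \<or> int p mod 3 = 2" by presburger
  have s8: "int p ^ 2 mod 8 = 1 mod 8" using odd_square_mod_8[of "int p"] odd by simp
  have s3: "int p ^ 2 mod 3 = 1 mod 3"
    using n3 by (auto simp: power2_eq_square mod_mult_eq[of "int p" 3 "int p", symmetric])
  have pos: "3 ^ a * int p ^ e > 0" using p by simp
  obtain x y where xy: "6 * y ^ 2 - x ^ 2 = 3 ^ a * int p ^ e"
    using norm_form_represents[OF pos M] t unfolding sqrt6_roots_def by blast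
  \<comment> \<open>For even e the number M would be 1 or 3 modulo 8.\<close>
  have "odd e"
  proof
    assume "even e"
    then obtain k where "e = 2 * k" by (elim evenE)
    then have "int p ^ e mod 8 = 1" using power_mod_of_square_mod(1)[OF s8] by simp
    moreover have "a = 0 \<or> a = 1" using a by auto
    ultimately show False using M by auto presburger
  qed
  then obtain k where k: "e = 2 * k + 1" by (elim oddE)
  define P where "P = int p ^ e"
  have P8: "P mod 8 = int p mod 8" and P3: "P mod 3 = int p mod 3"
    unfolding P_def k by (rule power_mod_of_square_mod(2)[OF s8], rule power_mod_of_square_mod(2)[OF s3])
  have "a = 0 \<or> a = 1" using a by auto
  then show ?thesis
  proof
    assume "a = 0"
    then have eq: "6 * y ^ 2 - x ^ 2 = P" and "P mod 8 = 7" using xy M by (auto simp: P_def)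
    have aux: "(6 * u - s) mod 3 \<noteq> 1" if "s mod 3 = 0 \<or> s mod 3 = 1" for s u :: int
      using that by presburger
    have "P mod 3 \<noteq> 1" unfolding eq[symmetric] by (rule aux[OF square_mod_3])
    then have "int (p mod 3) = int 2" using n3 P3 by (simp add: zmod_int)
    then have "p mod 3 = 2" by (simp only: of_nat_eq_iff)
    moreover have "int (p mod 8) = int 7" using P8 \<open>P mod 8 = 7\<close> by (simp add: zmod_int)
    then have "p mod 8 = 7" by (simp only: of_nat_eq_iff)
    ultimately show ?thesis using mod_24_eqI[of p 23] by simp
  next
    assume "a = 1"
    then have eq: "6 * y ^ 2 - x ^ 2 = 3 * P" and P: "3 * P mod 8 = 7" using xy M by (auto simp: P_def)
    \<comment> \<open>Here x is a multiple of 3; dividing the equation by 3 leaves P = 2y^2 - 3z^2,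
      which is never 1 modulo 3.\<close>
    have "x ^ 2 = 3 * (2 * y ^ 2 - P)" using eq by simp
    then have "3 dvd x ^ 2" by simp
    then have "3 dvd x" using prime_dvd_power_int[of 3 x 2] by simp
    then obtain z where "x = 3 * z" by (elim dvdE)
    then have eq: "2 * y ^ 2 - 3 * z ^ 2 = P" using eq by (simp add: power_mult_distrib)
    have aux: "(2 * s - 3 * u) mod 3 \<noteq> 1" if "s mod 3 = 0 \<or> s mod 3 = 1" for s u :: int
      using that by presburger
    have "P mod 3 \<noteq> 1" unfolding eq[symmetric] by (rule aux[OF square_mod_3])
    then have "int (p mod 3) = int 2" using n3 P3 by (simp add: zmod_int)
    then have "p mod 3 = 2" by (simp only: of_nat_eq_iff)
    moreover have "P mod 8 = 5" using P by presburger
    then have "int (p mod 8) = int 5" using P8 by (simp add: zmod_int)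
    then have "p mod 8 = 5" by (simp only: of_nat_eq_iff)
    ultimately show ?thesis using mod_24_eqI[of p 5] by simp
  qed
qed

text \<open>The count is odd exactly when the number of roots, its double, is not divisible by 4.
  For M of the stated form there are exactly two roots, since modulo 3 the only root is 0.\<close>

lemma odd_card_primitive_norm_sols:
  fixes M :: nat
  assumes M: "M mod 8 = 7"
  shows "odd (card (primitive_norm_sols (int M))) \<longleftrightarrow>
    (\<exists>p e a. prime p \<and> (p mod 24 = 5 \<or> p mod 24 = 23) \<and> e \<ge> 1 \<and> a \<le> 1 \<and> M = 3 ^ a * p ^ e)"
proof
  have Mi: "int M > 0" "int M mod 8 = 7" using M by presburger+
  have card: "card (sqrt6_roots (int M)) = 2 * card (primitive_norm_sols (int M))"
    by (rule card_sqrt6_roots[OF Mi])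
  {
    assume odd: "odd (card (primitive_norm_sols (int M)))"
    have not4: "\<not> 4 dvd card (sqrt6_roots (int M))"
      unfolding card using odd by presburger
    have "\<not> 9 dvd int M" using sqrt6_roots_9[of "int M"] not4 by auto
    then have not9: "\<not> 9 dvd M" by presburger
    obtain a B where aB: "a \<le> 1" "M = 3 ^ a * B" "\<not> 3 dvd B"
    proof (cases "3 dvd M")
      case True
      then obtain B where "M = 3 * B" by (elim dvdE)
      then show ?thesis using not9 by (intro that[of 1 B]) auto
    qed (auto intro: that[of 0 M])
    have "B \<noteq> 1"
    proof
      assume "B = 1"
      moreover have "a = 0 \<or> a = 1" using aB by auto
      ultimately show False using aB M by auto
    qed
    then obtain p where p: "prime p" "p dvd B" using prime_factor_nat by blast
    have "B \<noteq> 0" using aB(3) by (metis dvd_0_right)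
    then obtain e C where C: "B = p ^ e * C" "\<not> p dvd C"
      using multiplicity_decompose'[of B p] p by (metis not_prime_unit)
    have "e \<noteq> 0" using C p by (metis mult_1 power_0)
    have "odd M" using M by presburger
    then have oddp: "odd p" "odd C" using aB C \<open>e \<noteq> 0\<close> by auto
    have "p \<noteq> 3" "p \<noteq> 2" using p aB oddp by auto
    then have p3: "p > 3" using p by (metis One_nat_def Suc_lessI numeral_2_eq_2 numeral_3_eq_3 prime_gt_1_nat)
    have M_eq: "int M = int (p ^ e) * int (3 ^ a * C)" using aB C by simp
    have "C = 1"
    proof (rule ccontr)
      \<comment> \<open>Then p^e and 3^a C are coprime, odd and above 3, so each contributes an even
        factor to the number of roots.\<close>
      assume "C \<noteq> 1"
      have "coprime p (3 ^ a * C)"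
      proof -
        have "coprime p 3" using p \<open>p \<noteq> 3\<close> by (intro primes_coprime) auto
        moreover have "coprime p C" using p C by (simp add: prime_imp_coprime)
        ultimately show ?thesis by simp
      qed
      then have cop: "coprime (int (p ^ e)) (int (3 ^ a * C))" by (metis coprime_int_iff coprime_power_left_iff)
      have "\<not> 3 dvd C" using aB C by auto
      have "even (card (sqrt6_roots (int (p ^ e))))"
      proof (rule even_card_sqrt6_roots)
        have "p ^ 1 \<le> p ^ e" using \<open>e \<noteq> 0\<close> p3 by (intro power_increasing) auto
        then have "3 < p ^ e" using p3 by simp
        then show "int (p ^ e) > 3" by (metis of_nat_less_iff of_nat_numeral)
      qed (use oddp in auto)
      moreover have "even (card (sqrt6_roots (int (3 ^ a * C))))"
      proof (rule even_card_sqrt6_roots)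
        have "C > 3"
        proof -
          have "C \<noteq> 0" "C \<noteq> 2" "C \<noteq> 3" using \<open>odd C\<close> \<open>\<not> 3 dvd C\<close> by (metis dvd_0_right, auto)
          then show ?thesis using \<open>C \<noteq> 1\<close> by linarith
        qed
        moreover have "1 * C \<le> 3 ^ a * C" by (intro mult_right_mono) auto
        ultimately have "3 < 3 ^ a * C" by linarith
        then show "int (3 ^ a * C) > 3" by (metis of_nat_less_iff of_nat_numeral)
      qed (use oddp in auto)
      moreover have "card (sqrt6_roots (int M)) = card (sqrt6_roots (int (p ^ e))) * card (sqrt6_roots (int (3 ^ a * C)))"
        unfolding M_eq using p3 odd_pos[OF oddp(2)] by (intro card_sqrt6_roots_mult cop) auto
      ultimately have "2 * 2 dvd card (sqrt6_roots (int M))" by (metis mult_dvd_mono)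
      then show False using not4 by simp
    qed
    then have M3: "M = 3 ^ a * p ^ e" using aB C by simp
    have "sqrt6_roots (int M) \<noteq> {}" using not4 by auto
    then obtain t where "t \<in> sqrt6_roots (3 ^ a * int p ^ e)" using M3 by auto
    then have "p mod 24 = 5 \<or> p mod 24 = 23"
      using prime_residue_of_root[OF p(1) p3 aB(1), of e t] Mi(2) M3 by simp
    then show "\<exists>p e a. prime p \<and> (p mod 24 = 5 \<or> p mod 24 = 23) \<and> e \<ge> 1 \<and> a \<le> 1 \<and> M = 3 ^ a * p ^ e"
      using p M3 aB \<open>e \<noteq> 0\<close> by (intro exI[of _ p] exI[of _ e] exI[of _ a]) auto
  }
  {
    assume "\<exists>p e a. prime p \<and> (p mod 24 = 5 \<or> p mod 24 = 23) \<and> e \<ge> 1 \<and> a \<le> 1 \<and> M = 3 ^ a * p ^ e"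
    then obtain p e a where p: "prime p" "p mod 24 = 5 \<or> p mod 24 = 23" "e \<ge> 1" "a \<le> 1" "M = 3 ^ a * p ^ e"
      by blast
    have p3: "p > 3" using p(2) by presburger
    obtain t where t: "int p dvd t ^ 2 - 6" using exists_sqrt6_mod_prime[OF p(1,2)] by blast
    obtain e' where e': "e = Suc e'" using p(3) by (cases e) auto
    have two: "card (sqrt6_roots (int p ^ e)) = 2"
      unfolding e' using p p3 t by (intro card_sqrt6_roots_prime_power) auto
    have "coprime 3 p" using p p3 by (intro primes_coprime) auto
    then have "coprime 3 (int p ^ e)" by (metis coprime_int_iff coprime_power_right_iff of_nat_numeral)
    then have "card (sqrt6_roots (3 * int p ^ e)) = 2"
      using card_sqrt6_roots_mult[of 3 "int p ^ e"] two p3 by (simp add: sqrt6_roots_3)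
    moreover have "a = 0 \<or> a = 1" using p by auto
    ultimately have "card (sqrt6_roots (int M)) = 2" using two p(5) by auto
    then show "odd (card (primitive_norm_sols (int M)))" using card by simp
  }
qed

section \<open>Counting the solutions\<close>

lemma finite_square_divisors:
  fixes N :: nat
  assumes "N > 0"
  shows "finite {g. g ^ 2 dvd N}"
proof (rule finite_subset)
  show "{g. g ^ 2 dvd N} \<subseteq> {..N}"
  proof safe
    fix g assume "g ^ 2 dvd N"
    then have "g ^ 2 \<le> N" using assms by (intro dvd_imp_le)
    moreover have "g \<le> g ^ 2" by (simp add: power2_eq_square)
    ultimately show "g \<le> N" by simp
  qed
qed simp

text \<open>For N = 7 modulo 8 these are the g for which N / g^2 has an odd number of primitive
  solutions in \<open>primitive_norm_sols\<close>.\<close>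

definition square_cofactors :: "nat \<Rightarrow> nat set" where
  "square_cofactors N = {g. \<exists>p e a. prime p \<and> (p mod 24 = 5 \<or> p mod 24 = 23) \<and> e \<ge> 1 \<and> a \<le> 1 \<and>
     N = 3 ^ a * p ^ e * g ^ 2}"

text \<open>Solutions are sorted by g = gcd x y; dividing by g preserves 0 < x < 2y and divides the
  norm by g^2.\<close>

lemma card_norm_sols:
  assumes N: "N > 0"
  shows "card (norm_sols (int N)) = (\<Sum>g | g ^ 2 dvd N. card (primitive_norm_sols (int (N div g ^ 2))))"
proof -
  let ?D = "{g. g ^ 2 dvd N}"
  let ?S = "Sigma ?D (\<lambda>g. primitive_norm_sols (int (N div g ^ 2)))"
  let ?f = "\<lambda>(g, x, y). (int g * x, int g * y)"
  have finD: "finite ?D" by (rule finite_square_divisors[OF N])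
  have scale: "6 * (int g * y) ^ 2 - (int g * x) ^ 2 = int N \<longleftrightarrow> 6 * y ^ 2 - x ^ 2 = int (N div g ^ 2)"
    if "g ^ 2 dvd N" for g x y
  proof -
    have "g > 0" using that N by (auto intro: Nat.gr0I)
    have eq: "int N = int g ^ 2 * int (N div g ^ 2)"
      using that by (metis dvd_mult_div_cancel of_nat_mult of_nat_power)
    have "6 * (int g * y) ^ 2 - (int g * x) ^ 2 = int g ^ 2 * (6 * y ^ 2 - x ^ 2)"
      by (simp add: power_mult_distrib algebra_simps)
    then show ?thesis unfolding eq using \<open>g > 0\<close> by simp
  qed
  have "bij_betw ?f ?S (norm_sols (int N))"
  proof (rule bij_betw_byWitness[where f' = "\<lambda>(x, y). (nat (gcd x y), x div gcd x y, y div gcd x y)"])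
    show "\<forall>s\<in>?S. (\<lambda>(x, y). (nat (gcd x y), x div gcd x y, y div gcd x y)) (?f s) = s"
    proof
      fix s assume s: "s \<in> ?S"
      obtain g x y where gxy: "s = (g, x, y)" by (cases s)
      have *: "g ^ 2 dvd N" "coprime x y" using s by (auto simp: gxy primitive_norm_sols_def)
      have "g > 0" using * N by (auto intro: Nat.gr0I)
      moreover have "gcd (int g * x) (int g * y) = int g" using *(2) by (simp add: gcd_mult_left)
      ultimately show "(\<lambda>(x, y). (nat (gcd x y), x div gcd x y, y div gcd x y)) (?f s) = s"
        by (simp add: gxy)
    qed
    show "\<forall>s\<in>norm_sols (int N). ?f ((\<lambda>(x, y). (nat (gcd x y), x div gcd x y, y div gcd x y)) s) = s"
      by auto
    show "?f ` ?S \<subseteq> norm_sols (int N)"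
    proof
      fix s assume "s \<in> ?f ` ?S"
      then obtain g x y where *: "g ^ 2 dvd N" "(x, y) \<in> primitive_norm_sols (int (N div g ^ 2))"
        "s = (int g * x, int g * y)" by auto
      have "g > 0" using * N by (auto intro: Nat.gr0I)
      have xy: "0 < x" "x < 2 * y" "6 * y ^ 2 - x ^ 2 = int (N div g ^ 2)"
        using *(2) by (auto simp: primitive_norm_sols_def norm_sols_def)
      have "int g * x < int g * (2 * y)" using \<open>g > 0\<close> xy by (intro mult_strict_left_mono) auto
      then show "s \<in> norm_sols (int N)"
        using \<open>g > 0\<close> xy scale[OF *(1), of y x] by (simp add: *(3) norm_sols_def)
    qed
    show "(\<lambda>(x, y). (nat (gcd x y), x div gcd x y, y div gcd x y)) ` norm_sols (int N) \<subseteq> ?S"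
    proof safe
      fix x y assume xy: "(x, y) \<in> norm_sols (int N)"
      define g where "g = nat (gcd x y)"
      have *: "0 < x" "x < 2 * y" "6 * y ^ 2 - x ^ 2 = int N" using xy by (auto simp: norm_sols_def)
      have g: "int g = gcd x y" "g > 0" using * by (auto simp: g_def)
      obtain u v where uv: "x = int g * u" "y = int g * v" "coprime u v"
        using * unfolding g(1) by (metis gcd_coprime_exists gcd_eq_0_iff less_irrefl mult.commute)
      have "int N = int g ^ 2 * (6 * v ^ 2 - u ^ 2)"
        using *(3) unfolding uv by (simp add: power_mult_distrib algebra_simps)
      then have "int g ^ 2 dvd int N" by simp
      then have dv: "g ^ 2 dvd N" by (metis of_nat_dvd_iff of_nat_power)
      have "0 < u" using *(1) g(2) unfolding uv by (simp add: zero_less_mult_iff)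
      moreover have "int g * u < int g * (2 * v)" using *(2) unfolding uv by (simp add: algebra_simps)
      then have "u < 2 * v" using g(2) by simp
      ultimately have "(u, v) \<in> primitive_norm_sols (int (N div g ^ 2))"
        using scale[OF dv, of v u] *(3) uv by (simp add: primitive_norm_sols_def norm_sols_def)
      moreover have "x div int g = u" "y div int g = v" using g(2) uv by simp_all
      then have "x div gcd x y = u" "y div gcd x y = v" unfolding g(1) by simp_all
      ultimately show "nat (gcd x y) ^ 2 dvd N"
        "(x div gcd x y, y div gcd x y) \<in> primitive_norm_sols (int (N div nat (gcd x y) ^ 2))"
        using dv unfolding g_def[symmetric] by simp_all
    qed
  qed
  then have "card (norm_sols (int N)) = card ?S" by (simp add: bij_betw_same_card)
  also have "\<dots> = (\<Sum>g | g ^ 2 dvd N. card (primitive_norm_sols (int (N div g ^ 2))))"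
  proof (rule card_SigmaI[OF finD], rule ballI)
    fix g
    have "primitive_norm_sols (int (N div g ^ 2)) \<subseteq> norm_sols (int (N div g ^ 2))"
      by (auto simp: primitive_norm_sols_def)
    then show "finite (primitive_norm_sols (int (N div g ^ 2)))"
      using finite_norm_sols finite_subset by blast
  qed
  finally show ?thesis .
qed

text \<open>A sum has the parity of its number of odd summands. Odd squares are 1 modulo 8, so each
  N / g^2 is again 7 modulo 8.\<close>

lemma odd_card_norm_sols:
  assumes N: "N mod 8 = 7"
  shows "odd (card (norm_sols (int N))) \<longleftrightarrow> odd (card (square_cofactors N))"
proof -
  let ?D = "{g. g ^ 2 dvd N}"
  have "N > 0" using N by (auto intro: Nat.gr0I)
  have finD: "finite ?D" by (rule finite_square_divisors[OF \<open>N > 0\<close>])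
  have "{g \<in> ?D. odd (card (primitive_norm_sols (int (N div g ^ 2))))} = square_cofactors N"
  proof (intro subset_antisym subsetI)
    have mod: "N div g ^ 2 mod 8 = 7" if "g ^ 2 dvd N" for g
    proof -
      have eq: "N = g ^ 2 * (N div g ^ 2)" using that by simp
      have "odd N" using N by presburger
      then have "odd g" using eq by (metis even_mult_iff even_power pos2)
      then have "int g ^ 2 mod 8 = 1" by (intro odd_square_mod_8) simp
      then have "g ^ 2 mod 8 = 1" by (metis of_nat_power of_nat_numeral of_nat_1 zmod_int of_nat_eq_iff)
      then have "N mod 8 = 1 * (N div g ^ 2) mod 8" by (metis eq mod_mult_left_eq)
      then show ?thesis using N by simp
    qed
    {
      fix g assume g: "g \<in> {g \<in> ?D. odd (card (primitive_norm_sols (int (N div g ^ 2))))}"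
      then have dv: "g ^ 2 dvd N" by simp
      obtain p e a where p: "prime p" "p mod 24 = 5 \<or> p mod 24 = 23" "e \<ge> 1" "a \<le> 1" "N div g ^ 2 = 3 ^ a * p ^ e"
        using g odd_card_primitive_norm_sols[OF mod[OF dv]] by auto
      have "N = 3 ^ a * p ^ e * g ^ 2" using dv p(5) by (metis dvd_div_mult_self)
      then show "g \<in> square_cofactors N" unfolding square_cofactors_def using p by blast
    next
      fix g assume "g \<in> square_cofactors N"
      then obtain p e a where p: "prime p" "p mod 24 = 5 \<or> p mod 24 = 23" "e \<ge> 1" "a \<le> 1" "N = 3 ^ a * p ^ e * g ^ 2"
        unfolding square_cofactors_def by blast
      have dv: "g ^ 2 dvd N" using p by simp
      have "g > 0" using \<open>N > 0\<close> p(5) by (auto intro: Nat.gr0I)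
      then have "N div g ^ 2 = 3 ^ a * p ^ e" using p by simp
      then show "g \<in> {g \<in> ?D. odd (card (primitive_norm_sols (int (N div g ^ 2))))}"
        using p dv odd_card_primitive_norm_sols[OF mod[OF dv]] by blast
    }
  qed
  then show ?thesis unfolding card_norm_sols[OF \<open>N > 0\<close>] even_sum_iff[OF finD] by simp
qed

text \<open>As c is odd, comparing exponents of p forces the prime in any other decomposition to be
  p, with exponent c - 2i; comparing exponents of 3 forces a = b mod 2. Only i remains free.\<close>

lemma square_cofactors_eq:
  assumes p: "prime p" "p mod 24 = 5 \<or> p mod 24 = 23" and l: "l > 0" "\<not> p dvd l" and c: "odd c"
    and N: "N = 3 ^ b * l ^ 2 * p ^ c"
  shows "square_cofactors N = (\<lambda>i. 3 ^ (b div 2) * l * p ^ i) ` {..c div 2}"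
proof (intro subset_antisym subsetI)
  have p3: "p \<noteq> 3" "p > 0" using p(2) by auto
  fix g assume "g \<in> square_cofactors N"
  then obtain r e a where r: "prime r" "r mod 24 = 5 \<or> r mod 24 = 23" "e \<ge> 1" "a \<le> 1" "N = 3 ^ a * r ^ e * g ^ 2"
    unfolding square_cofactors_def by blast
  have "N > 0" using N l p3 by simp
  then have "g > 0" using r(5) by (auto intro: Nat.gr0I)
  have r3: "r \<noteq> 3" "r > 0" using r(2) by auto
  have p30: "multiplicity p 3 = 0" using p p3 by (simp add: prime_multiplicity_other)
  have vpN: "multiplicity p N = c"
    using l p p3 p30 unfolding N
    by (simp add: prime_elem_multiplicity_mult_distrib prime_elem_multiplicity_power_distrib
        not_dvd_imp_multiplicity_0)
  have vpN': "multiplicity p N = e * multiplicity p r + 2 * multiplicity p g"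
    using \<open>g > 0\<close> p p3 r3 p30 unfolding r(5)
    by (simp add: prime_elem_multiplicity_mult_distrib prime_elem_multiplicity_power_distrib)
  have "p = r"
  proof (rule ccontr)
    assume "p \<noteq> r"
    then have "multiplicity p r = 0" using p r by (simp add: prime_multiplicity_other)
    then have "c = 2 * multiplicity p g" using vpN vpN' by simp
    then show False using c by presburger
  qed
  define i where "i = multiplicity p g"
  have "multiplicity p p = 1" using p(1) by simp
  then have e: "c = e + 2 * i" using vpN vpN' unfolding \<open>p = r\<close>[symmetric] i_def by simp
  obtain h where h: "g = p ^ i * h" "\<not> p dvd h"
    using multiplicity_decompose'[of g p] \<open>g > 0\<close> p unfolding i_def by (metis not_prime_unit less_irrefl)
  have "p ^ c * (3 ^ b * l ^ 2) = p ^ c * (3 ^ a * h ^ 2)"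
    using r(5) unfolding N e h(1) \<open>p = r\<close>[symmetric]
    by (simp add: power_add power_mult power_mult_distrib power2_eq_square mult_ac)
  then have eq: "3 ^ b * l ^ 2 = 3 ^ a * h ^ 2" using p3 by simp
  have "h > 0" using h(2) by (auto intro: Nat.gr0I)
  have "prime (3::nat)" by simp
  then have "b + 2 * multiplicity 3 l = a + 2 * multiplicity 3 h"
    using arg_cong[OF eq, of "multiplicity 3"] l \<open>h > 0\<close>
    by (simp add: prime_elem_multiplicity_mult_distrib prime_elem_multiplicity_power_distrib)
  then have a: "a = b mod 2" using r(4) by presburger
  have "(3 :: nat) ^ b = 3 ^ a * (3 ^ (b div 2)) ^ 2"
    unfolding a power_mult[symmetric] power_add[symmetric] by simp
  then have "3 ^ a * (3 ^ (b div 2) * l) ^ 2 = 3 ^ a * h ^ 2"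
    using eq by (simp add: power_mult_distrib)
  then have "(3 ^ (b div 2) * l) ^ 2 = h ^ 2" by simp
  then have "h = 3 ^ (b div 2) * l" by (simp add: power2_eq_iff_nonneg)
  then have "g = 3 ^ (b div 2) * l * p ^ i" using h by simp
  moreover have "i \<le> c div 2" using e by simp
  ultimately show "g \<in> (\<lambda>i. 3 ^ (b div 2) * l * p ^ i) ` {..c div 2}" by blast
next
  fix g assume "g \<in> (\<lambda>i. 3 ^ (b div 2) * l * p ^ i) ` {..c div 2}"
  then obtain i where i: "i \<le> c div 2" "g = 3 ^ (b div 2) * l * p ^ i" by blast
  define e where "e = c - 2 * i"
  have e: "c = e + 2 * i" "e \<ge> 1" using i c by (auto simp: e_def elim!: oddE)
  have "(3 :: nat) ^ b = 3 ^ (b mod 2) * (3 ^ (b div 2)) ^ 2"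
    unfolding power_mult[symmetric] power_add[symmetric] by simp
  then have "N = 3 ^ (b mod 2) * p ^ e * g ^ 2"
    unfolding N e(1) i(2) by (simp add: power_add power_mult power_mult_distrib power2_eq_square mult_ac)
  moreover have "b mod 2 \<le> 1" by simp
  ultimately show "g \<in> square_cofactors N" unfolding square_cofactors_def using p e by blast
qed

lemma card_square_cofactors:
  assumes p: "prime p" "p mod 24 = 5 \<or> p mod 24 = 23" and l: "l > 0" "\<not> p dvd l" and c: "odd c"
    and N: "N = 3 ^ b * l ^ 2 * p ^ c"
  shows "card (square_cofactors N) = Suc (c div 2)"
proof -
  have "p > 1" using p prime_gt_1_nat by blast
  then have "inj_on (\<lambda>i. 3 ^ (b div 2) * l * p ^ i) {..c div 2}"
    using l by (auto simp: inj_on_def)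
  then show ?thesis unfolding square_cofactors_eq[OF assms] by (simp add: card_image)
qed

text \<open>One member of \<open>square_cofactors\<close> fixes p and an odd c, and then the set has
  (c + 1)/2 elements, an odd number exactly for c = 1 modulo 4.\<close>

lemma odd_card_square_cofactors:
  assumes N: "N mod 8 = 7"
  shows "odd (card (square_cofactors N)) \<longleftrightarrow>
    (\<exists>p l b c. prime p \<and> (p mod 24 = 5 \<or> p mod 24 = 23) \<and> l \<ge> 1 \<and> \<not> p dvd l \<and> c mod 4 = 1 \<and>
      N = 3 ^ b * l ^ 2 * p ^ c)"
proof
  assume odd: "odd (card (square_cofactors N))"
  then have "square_cofactors N \<noteq> {}" by auto
  then obtain g p e a where p: "prime p" "p mod 24 = 5 \<or> p mod 24 = 23" "e \<ge> 1" "a \<le> 1" "N = 3 ^ a * p ^ e * g ^ 2"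
    unfolding square_cofactors_def by blast
  have "g > 0" using N p(5) by (auto intro: Nat.gr0I)
  then obtain i l where l: "g = p ^ i * l" "\<not> p dvd l"
    using multiplicity_decompose'[of g p] p by (metis not_prime_unit less_irrefl)
  have "l > 0" using \<open>g > 0\<close> l by (auto intro: Nat.gr0I)
  define c where "c = e + 2 * i"
  have eq: "N = 3 ^ a * l ^ 2 * p ^ c"
    unfolding p(5) l(1) c_def by (simp add: power_add power_mult power_mult_distrib power2_eq_square mult_ac)
  \<comment> \<open>Otherwise N would be a square or three times a square, and neither is 7 modulo
    8.\<close>
  have "odd c"
  proof
    assume "even c"
    then obtain k where k: "c = 2 * k" by (elim evenE)
    have "int N = 3 ^ a * (int l * int p ^ k) ^ 2"
      unfolding eq k by (simp add: power_mult_distrib power_mult power2_eq_square mult_ac)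
    then obtain s where s: "int N = 3 ^ a * s ^ 2" by blast
    have "int N mod 8 = 7" using N by presburger
    moreover have "a = 0 \<or> a = 1" using p by auto
    ultimately show False using s square_mod_8[of s] by auto presburger+
  qed
  then have "card (square_cofactors N) = Suc (c div 2)"
    using card_square_cofactors[OF p(1,2) \<open>l > 0\<close> l(2) _ eq] by simp
  then have "c mod 4 = 1" using odd \<open>odd c\<close> by presburger
  then show "\<exists>p l b c. prime p \<and> (p mod 24 = 5 \<or> p mod 24 = 23) \<and> l \<ge> 1 \<and> \<not> p dvd l \<and> c mod 4 = 1 \<and>
      N = 3 ^ b * l ^ 2 * p ^ c"
    using p(1,2) \<open>l > 0\<close> l(2) eq
    by (intro exI[of _ p] exI[of _ l] exI[of _ a] exI[of _ c]) auto
next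
  assume "\<exists>p l b c. prime p \<and> (p mod 24 = 5 \<or> p mod 24 = 23) \<and> l \<ge> 1 \<and> \<not> p dvd l \<and> c mod 4 = 1 \<and>
      N = 3 ^ b * l ^ 2 * p ^ c"
  then obtain p l b c where p: "prime p" "p mod 24 = 5 \<or> p mod 24 = 23" and l: "l \<ge> 1" "\<not> p dvd l"
    and c: "c mod 4 = 1" and eq: "N = 3 ^ b * l ^ 2 * p ^ c" by blast
  have "odd c" using c by presburger
  then have "card (square_cofactors N) = Suc (c div 2)"
    using card_square_cofactors[OF p _ l(2) _ eq] l by simp
  then show "odd (card (square_cofactors N))" using c by presburger
qed

theorem theorem1p3:
  fixes n :: nat
  shows "odd (u2 n) \<longleftrightarrow>
    (\<exists>(p::nat) (l::nat) (b::nat) (c::nat).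
       prime p \<and> (p mod 24 = 5 \<or> p mod 24 = 23) \<and> l \<ge> 1 \<and> \<not> p dvd l \<and> c mod 4 = 1 \<and>
       8 * int n - 1 = 3 ^ b * int l ^ 2 * int p ^ c)"
proof (cases "n = 0")
  case True
  \<comment> \<open>Reduced solutions have norm 6y^2 - x^2 > 2y^2, so the negative value -1 at n = 0
    has none.\<close>
  have "norm_sols (- 1) = {}"
  proof -
    have "6 * y ^ 2 - x ^ 2 \<noteq> - 1" if "0 < x" "x < 2 * y" for x y :: int
    proof -
      have "x ^ 2 < (2 * y) ^ 2" using that by (intro power_strict_mono) auto
      then have "x ^ 2 < 4 * y ^ 2" by (simp add: power_mult_distrib)
      then show ?thesis using zero_le_power2[of y] by linarith
    qed
    then show ?thesis by (auto simp: norm_sols_def)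
  qed
  then have "even (u2 n)" using odd_u2_iff_card_norm_sols[of n] True by simp
  moreover have "8 * int n - 1 \<noteq> 3 ^ b * int l ^ 2 * int p ^ c" for p l b c :: nat
  proof -
    have "0 \<le> 3 ^ b * int l ^ 2 * int p ^ c" by simp
    then show ?thesis using True by linarith
  qed
  ultimately show ?thesis by blast
next
  case False
  then obtain m where m: "n = Suc m" by (cases n) auto
  \<comment> \<open>With n = m + 1 this is 8n - 1 as a natural number, free of truncated
    subtraction.\<close>
  define N where "N = 8 * m + 7"
  have N: "8 * int n - 1 = int N" "N mod 8 = 7" by (simp_all add: N_def m)
  have eq: "int N = 3 ^ b * int l ^ 2 * int p ^ c \<longleftrightarrow> N = 3 ^ b * l ^ 2 * p ^ c" for p l b c :: nat
    using of_nat_eq_iff[of N "3 ^ b * l ^ 2 * p ^ c", where 'a = int] by simp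
  show ?thesis
    unfolding odd_u2_iff_card_norm_sols N(1) odd_card_norm_sols[OF N(2)]
      odd_card_square_cofactors[OF N(2)] eq ..
qed

end
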